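(* Let $a\in(-\infty,0)\cup(0,1)$ and let $\omega\in\mathbb D_a$ satisfy $R_a(\omega)=\omega$; let $L_\omega=\sup\{x:\omega(x)>0\}$. Then: (1) if $a<0$, $\omega>0$ on $\mathbb R$ and $\omega'\in H^k(\mathbb R)$ for every integer $k\ge0$; (2) if $0<a<1$, $\omega$ is supported on $[-L_\omega,L_\omega]$ with $L_\omega<\infty$, and $\omega$ is $C^\infty$ on the open interval $(-L_\omega,L_\omega)$.
   Context: Let $\rho(x)=(1+|x|)^{-1/2}$ and $\eta_a=\frac{1}{2^{9/2}(4+|a|)^3}$. $\mathbb D_a$ is the set of continuous even functions $\omega$ on $\mathbb R$ with $\|\rho\omega\|_{L^\infty}<\infty$ such that $\omega(0)=1$; $(1-x^2)_+\le\omega(x)\le1$ for all $x$; $\omega$ is non-increasing on $[0,\infty)$; $s\mapsto\omega(\sqrt s)$ is convex on $[0,\infty)$; and the left derivative satisfies $\omega'_-(1/2)\le-\eta_a$. $T(\omega)(x)=\frac1\pi\int_0^\infty\ln\left|\frac{x^2-y^2}{y^2}\right|\omega(y)\,dy$, $r(\omega)=\frac1\pi\int_0^\infty\frac{\omega(0)-\omega(y)}{y^2}\,dy$, and for $a\ne0$, $R_a(\omega)(x)=\big(1-\frac{aT(\omega)(x)}{r(\omega)}\big)_+^{1/a}$. $H^k$ denotes the $L^2$-based Sobolev space of order $k$. *)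

theory Defs
  imports "HOL-Analysis.Analysis"
begin

definition rho :: "real \<Rightarrow> real" where
  "rho x = (1 + \<bar>x\<bar>) powr (-1/2)"

definition eta :: "real \<Rightarrow> real" where
  "eta a = 1 / (2 powr (9/2) * (4 + \<bar>a\<bar>) ^ 3)"

definition Dset :: "real \<Rightarrow> (real \<Rightarrow> real) set" where
  "Dset a = {\<omega>. continuous_on UNIV \<omega>
      \<and> (\<forall>x. \<omega> (-x) = \<omega> x)
      \<and> (\<exists>B. \<forall>x. \<bar>rho x * \<omega> x\<bar> \<le> B)
      \<and> \<omega> 0 = 1
      \<and> (\<forall>x. max 0 (1 - x^2) \<le> \<omega> x \<and> \<omega> x \<le> 1)
      \<and> (\<forall>x y. 0 \<le> x \<longrightarrow> x \<le> y \<longrightarrow> \<omega> y \<le> \<omega> x)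
      \<and> convex_on {0..} (\<lambda>s. \<omega> (sqrt s))
      \<and> (\<exists>L. ((\<lambda>h. (\<omega> (1/2 + h) - \<omega> (1/2)) / h) \<longlongrightarrow> L) (at_left 0) \<and> L \<le> - eta a)}"

definition Top :: "(real \<Rightarrow> real) \<Rightarrow> real \<Rightarrow> real" where
  "Top \<omega> x = (1/pi) * (LBINT y:{0<..}. ln \<bar>(x^2 - y^2) / y^2\<bar> * \<omega> y)"

definition rfun :: "(real \<Rightarrow> real) \<Rightarrow> real" where
  "rfun \<omega> = (1/pi) * (LBINT y:{0<..}. (\<omega> 0 - \<omega> y) / y^2)"

text \<open>R_a(omega)(x) = (1 - a T(omega)(x)/r(omega))_+^(1/a), valued in the extended reals:
  a zero base raised to the negative power 1/a (case a < 0) is +infinity.\<close>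
definition Ra :: "real \<Rightarrow> (real \<Rightarrow> real) \<Rightarrow> real \<Rightarrow> ereal" where
  "Ra a \<omega> x = (let b = max 0 (1 - a * Top \<omega> x / rfun \<omega>) in
      if b > 0 then ereal (b powr (1/a))
      else if a > 0 then 0 else \<infinity>)"

definition smooth_on_set :: "real set \<Rightarrow> (real \<Rightarrow> real) \<Rightarrow> bool" where
  "smooth_on_set S f \<longleftrightarrow> (\<exists>fs :: nat \<Rightarrow> real \<Rightarrow> real. fs 0 = f \<and>
      (\<forall>n. \<forall>x\<in>S. (fs n has_real_derivative fs (Suc n) x) (at x)))"

definition test_fun :: "(nat \<Rightarrow> real \<Rightarrow> real) \<Rightarrow> bool" where
  "test_fun fs \<longleftrightarrow> (\<forall>n x. (fs n has_real_derivative fs (Suc n) x) (at x))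
      \<and> (\<exists>K. compact K \<and> (\<forall>x. x \<notin> K \<longrightarrow> fs 0 x = 0))"

definition weak_deriv :: "(real \<Rightarrow> real) \<Rightarrow> (real \<Rightarrow> real) \<Rightarrow> bool" where
  "weak_deriv f g \<longleftrightarrow> (\<forall>a b. set_integrable lborel {a..b} g)
      \<and> (\<forall>fs. test_fun fs \<longrightarrow>
            (LINT x|lborel. f x * fs 1 x) = - (LINT x|lborel. g x * fs 0 x))"

definition L2 :: "(real \<Rightarrow> real) \<Rightarrow> bool" where
  "L2 f \<longleftrightarrow> f \<in> borel_measurable lborel \<and> integrable lborel (\<lambda>x. (f x)^2)"

definition sobolev_H :: "nat \<Rightarrow> (real \<Rightarrow> real) \<Rightarrow> bool" where
  "sobolev_H k f \<longleftrightarrow> (\<exists>gs :: nat \<Rightarrow> real \<Rightarrow> real. gs 0 = f \<and>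
      (\<forall>j\<le>k. L2 (gs j) \<and>
        (\<forall>fs. test_fun fs \<longrightarrow>
           (LINT x|lborel. f x * fs j x) = (-1)^j * (LINT x|lborel. gs j x * fs 0 x))))"

end

theory Submission
  imports Defs "HOL-Real_Asymp.Real_Asymp"
begin

text \<open>
  Convexity of \<open>s \<mapsto> \<omega> (sqrt s)\<close> gives \<open>\<omega>\<close> slope \<open>O(1 / (1 + \<bar>x\<bar>))\<close>, so the symmetric Hilbert transform
  \<open>H x = \<integral>\<^sub>0\<^sup>\<infinity> (\<omega> (x - t) - \<omega> (x + t)) / t dt\<close> converges absolutely and is bounded. Moving the
  logarithmic singularity of the kernel of \<open>T\<close> to the origin and integrating by parts gives
  \<open>\<pi> T(\<omega>)' = H\<close>. Where \<open>\<omega> > 0\<close> the fixed point equation becomes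
  \<open>(\<omega>\<^sup>q)' = - q / (\<pi> r) \<omega>\<^sup>q\<^sup>-\<^sup>a H\<close>. The Hilbert transform preserves Hoelder classes up to a
  loss in the exponent, so each use of this identity gains one derivative. For \<open>a < 0\<close> all bounds are
  uniform on the line and every derivative of \<open>\<omega>\<close> is \<open>\<omega>\<^sup>1\<^sup>-\<^sup>a\<close> times a bounded function; for
  \<open>a > 0\<close> they are uniform on compact subintervals of \<open>{\<omega> > 0}\<close>.

  With the excess \<open>M x = \<integral>\<^sub>0\<^sup>x (\<omega> y - \<omega> x) dy\<close> one has \<open>H x \<ge> M x / x\<close>. Since \<open>M\<close> is increasing,
  \<open>T(\<omega>)\<close> grows at least logarithmically, which forces compact support for \<open>a > 0\<close>. For \<open>a < 0\<close> it gives
  \<open>(ln M)' \<ge> \<omega>\<^sup>1\<^sup>-\<^sup>a / (\<pi> r)\<close>, and \<open>M x \<le> x\<close> yields \<open>\<omega>\<^sup>1\<^sup>-\<^sup>a = O(ln x / x)\<close>, which is square integrable.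
\<close>

section \<open>Integration on the real line\<close>

lemma tendsto_integral_dominated_at:
  fixes s :: "'b::first_countable_topology \<Rightarrow> 'a \<Rightarrow> 'c::{banach, second_countable_topology}"
  assumes lim: "\<And>t. ((\<lambda>h. s h t) \<longlongrightarrow> f t) (at x)"
    and meas: "\<forall>\<^sub>F h in at x. s h \<in> borel_measurable M"
    and bound: "\<forall>\<^sub>F h in at x. \<forall>t. norm (s h t) \<le> g t"
    and g: "integrable M g"
  shows "((\<lambda>h. integral\<^sup>L M (s h)) \<longlongrightarrow> integral\<^sup>L M f) (at x)"
  unfolding tendsto_at_iff_sequentially comp_def
proof (intro allI impI)
  fix X :: "nat \<Rightarrow> 'b"
  assume "\<forall>i. X i \<in> UNIV - {x}" and "X \<longlonglongrightarrow> x"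
  then have X: "filterlim X (at x) sequentially"
    by (intro filterlim_atI) auto
  then have "\<forall>\<^sub>F i in sequentially. s (X i) \<in> borel_measurable M \<and> (\<forall>t. norm (s (X i) t) \<le> g t)"
    by (rule eventually_compose_filterlim[OF eventually_conj[OF meas bound]])
  then obtain N where "\<forall>i\<ge>N. s (X i) \<in> borel_measurable M \<and> (\<forall>t. norm (s (X i) t) \<le> g t)"
    unfolding eventually_sequentially by blast
  then have N: "s (X (i + N)) \<in> borel_measurable M" "norm (s (X (i + N)) t) \<le> g t" for i t
    by simp_all
  have lim_X: "(\<lambda>i. s (X (i + N)) t) \<longlonglongrightarrow> f t" for t
    by (intro LIMSEQ_ignore_initial_segment filterlim_compose[OF lim X])
  have "(\<lambda>i. integral\<^sup>L M (s (X (i + N)))) \<longlonglongrightarrow> integral\<^sup>L M f"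
    by (rule integral_dominated_convergence[OF borel_measurable_LIMSEQ_metric[OF N(1) lim_X] N(1) g])
      (use lim_X N in auto)
  then show "(\<lambda>i. integral\<^sup>L M (s (X i))) \<longlonglongrightarrow> integral\<^sup>L M f"
    by (rule LIMSEQ_offset)
qed

lemma abs_difference_quotient_le:
  fixes f f' :: "real \<Rightarrow> real"
  assumes deriv: "\<And>x. \<bar>x - x0\<bar> < d \<Longrightarrow> (f has_real_derivative f' x) (at x)"
    and bound: "\<And>x. \<bar>x - x0\<bar> < d \<Longrightarrow> \<bar>f' x\<bar> \<le> B" and h: "\<bar>h\<bar> < d" "h \<noteq> 0"
  shows "\<bar>(f (x0 + h) - f x0) / h\<bar> \<le> B"
proof -
  have "norm (f (x0 + h) - f x0) \<le> B * norm (x0 + h - x0)"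
  proof (rule field_differentiable_bound[where S = "closed_segment x0 (x0 + h)" and f' = f'])
    fix z assume "z \<in> closed_segment x0 (x0 + h)"
    then have z: "\<bar>z - x0\<bar> < d"
      using h by (auto simp: closed_segment_eq_real_ivl split: if_splits)
    show "(f has_field_derivative f' z) (at z within closed_segment x0 (x0 + h))"
      using deriv[OF z] by (rule has_field_derivative_at_within)
    show "norm (f' z) \<le> B" using bound[OF z] by simp
  qed auto
  then show ?thesis using h by (simp add: abs_divide divide_le_eq)
qed

lemma has_real_derivative_integral_dominated:
  fixes f f' :: "real \<Rightarrow> 'a \<Rightarrow> real"
  assumes "d > 0"
    and integrable: "\<And>x. \<bar>x - x0\<bar> < d \<Longrightarrow> integrable M (f x)"
    and deriv: "\<And>x t. \<bar>x - x0\<bar> < d \<Longrightarrow> ((\<lambda>x. f x t) has_real_derivative f' x t) (at x)"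
    and bound: "\<And>x t. \<bar>x - x0\<bar> < d \<Longrightarrow> \<bar>f' x t\<bar> \<le> g t"
    and "integrable M g"
  shows "((\<lambda>x. \<integral>t. f x t \<partial>M) has_real_derivative (\<integral>t. f' x0 t \<partial>M)) (at x0)"
proof -
  have near_0: "\<forall>\<^sub>F h in at 0. \<bar>h\<bar> < d \<and> h \<noteq> 0"
    unfolding eventually_at using \<open>d > 0\<close> by (auto simp: dist_real_def)
  have "((\<lambda>h. \<integral>t. (f (x0 + h) t - f x0 t) / h \<partial>M) \<longlongrightarrow> (\<integral>t. f' x0 t \<partial>M)) (at 0)"
  proof (rule tendsto_integral_dominated_at[OF _ _ _ \<open>integrable M g\<close>])
    show "((\<lambda>h. (f (x0 + h) t - f x0 t) / h) \<longlongrightarrow> f' x0 t) (at 0)" for t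
      using deriv[of x0 t] \<open>d > 0\<close> by (simp add: DERIV_def)
    show "\<forall>\<^sub>F h in at 0. (\<lambda>t. (f (x0 + h) t - f x0 t) / h) \<in> borel_measurable M"
      using near_0 by eventually_elim
        (use integrable[of x0] integrable[of "x0 + _"] \<open>d > 0\<close>
          in \<open>auto intro!: borel_measurable_divide borel_measurable_diff\<close>)
    show "\<forall>\<^sub>F h in at 0. \<forall>t. norm ((f (x0 + h) t - f x0 t) / h) \<le> g t"
      using near_0 by eventually_elim (use abs_difference_quotient_le[OF deriv bound] in auto)
  qed
  moreover have "\<forall>\<^sub>F h in at 0. (\<integral>t. (f (x0 + h) t - f x0 t) / h \<partial>M)
      = ((\<integral>t. f (x0 + h) t \<partial>M) - (\<integral>t. f x0 t \<partial>M)) / h"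
    using near_0 by eventually_elim
      (use integrable[of x0] integrable[of "x0 + _"] \<open>d > 0\<close>
        in \<open>simp add: Bochner_Integration.integral_diff\<close>)
  ultimately show ?thesis
    unfolding DERIV_def by (rule Lim_transform_eventually)
qed

lemma has_real_derivative_set_integral_dominated:
  fixes f f' :: "real \<Rightarrow> 'a \<Rightarrow> real"
  assumes "d > 0"
    and "\<And>x. \<bar>x - x0\<bar> < d \<Longrightarrow> set_integrable M A (f x)"
    and "\<And>x t. \<bar>x - x0\<bar> < d \<Longrightarrow> t \<in> A \<Longrightarrow> ((\<lambda>x. f x t) has_real_derivative f' x t) (at x)"
    and "\<And>x t. \<bar>x - x0\<bar> < d \<Longrightarrow> t \<in> A \<Longrightarrow> \<bar>f' x t\<bar> \<le> g t"
    and "set_integrable M A g"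
  shows "((\<lambda>x. LINT t:A|M. f x t) has_real_derivative (LINT t:A|M. f' x0 t)) (at x0)"
  unfolding set_lebesgue_integral_def
  by (rule has_real_derivative_integral_dominated[where d = d and g = "\<lambda>t. indicator A t *\<^sub>R g t"])
    (use assms in \<open>auto simp: set_integrable_def indicator_def\<close>)

lemma set_integrable_Ici_if_Ioi:
  fixes f :: "real \<Rightarrow> real"
  assumes "set_integrable lborel {a<..} f"
  shows "set_integrable lborel {a..} f"
proof -
  have "integrable lborel (\<lambda>x. indicator {a} x *\<^sub>R f a)" by simp
  also have "(\<lambda>x. indicator {a} x *\<^sub>R f a) = (\<lambda>x. indicator {a} x *\<^sub>R f x)"
    by (auto simp: indicator_def)
  finally have "set_integrable lborel {a} f" by (simp add: set_integrable_def)
  then have "set_integrable lborel ({a} \<union> {a<..}) f"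
    using assms by (intro set_integrable_Un) auto
  then show ?thesis by (simp only: ivl_disj_un_singleton)
qed

lemma set_integral_Ici_eq_Ioi:
  fixes f :: "real \<Rightarrow> real"
  assumes "set_integrable lborel {a<..} f"
  shows "(LBINT t:{a..}. f t) = (LBINT t:{a<..}. f t)"
proof (rule set_integral_cong_set)
  show "set_borel_measurable lborel {a..} f" "set_borel_measurable lborel {a<..} f"
    using set_integrable_Ici_if_Ioi[OF assms] assms
    by (simp_all add: set_integrable_def set_borel_measurable_def)
  show "AE t in lborel. t \<in> {a<..} \<longleftrightarrow> t \<in> {a..}"
    using AE_lborel_singleton[of a] by eventually_elim auto
qed

lemma integrable_even_if_set_integrable_Ioi:
  fixes f :: "real \<Rightarrow> real"
  assumes "set_integrable lborel {0<..} f" and "\<And>x. f (- x) = f x"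
  shows "integrable lborel f"
proof -
  have "integrable lborel (\<lambda>x. indicator {0..} x *\<^sub>R f x)"
    using set_integrable_Ici_if_Ioi[OF assms(1)] by (simp only: set_integrable_def)
  from has_bochner_integral_even_function[OF has_bochner_integral_integrable[OF this] assms(2)]
  show ?thesis by (simp add: has_bochner_integral_iff)
qed

lemma tendsto_integral_Icc_at_top:
  fixes f :: "real \<Rightarrow> real"
  assumes "set_integrable lborel {a<..} f"
  shows "((\<lambda>B. integral {a..B} f) \<longlongrightarrow> (LBINT t:{a<..}. f t)) at_top"
proof -
  note int = set_integrable_Ici_if_Ioi[OF assms]
  have "((\<lambda>B. LBINT t:{a..B}. f t) \<longlongrightarrow> (LBINT t:{a..}. f t)) at_top"
    by (rule tendsto_set_lebesgue_integral_at_top[OF _ int]) simp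
  moreover have "(LBINT t:{a..B}. f t) = integral {a..B} f" for B
    by (rule set_borel_integral_eq_integral, rule set_integrable_subset[OF int]) auto
  ultimately show ?thesis by (simp add: set_integral_Ici_eq_Ioi[OF assms])
qed

lemma set_borel_measurable_continuous_on:
  fixes f :: "real \<Rightarrow> real"
  assumes "A \<in> sets borel" "continuous_on A f"
  shows "set_borel_measurable lborel A f"
  using borel_measurable_continuous_on_indicator[OF assms] by (simp add: set_borel_measurable_def)

lemma set_integrable_continuous_dominated:
  fixes f g :: "real \<Rightarrow> real"
  assumes "set_integrable lborel A g" "A \<in> sets borel" "continuous_on A f"
    and "\<And>t. t \<in> A \<Longrightarrow> \<bar>f t\<bar> \<le> g t"
  shows "set_integrable lborel A f"
proof (rule set_integrable_bound[OF assms(1) set_borel_measurable_continuous_on])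
  show "AE x in lborel. x \<in> A \<longrightarrow> norm (f x) \<le> norm (g x)"
    using assms(4) by (auto simp: order.trans[OF _ abs_ge_self])
qed (use assms in auto)

lemma set_integral_abs_le:
  fixes f g :: "'a \<Rightarrow> real"
  assumes "set_integrable M A f" "set_integrable M A g" "\<And>t. t \<in> A \<Longrightarrow> \<bar>f t\<bar> \<le> g t"
  shows "\<bar>LINT t:A|M. f t\<bar> \<le> (LINT t:A|M. g t)"
proof -
  have "norm (LINT t:A|M. f t) \<le> (LINT t:A|M. norm (f t))"
    by (rule set_integral_norm_bound[OF assms(1)])
  also have "\<dots> \<le> (LINT t:A|M. g t)"
    by (rule set_integral_mono[OF set_integrable_norm[OF assms(1)] assms(2)]) (use assms(3) in auto)
  finally show ?thesis by simp
qed

lemma set_integral_nonneg: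
  fixes f :: "'a \<Rightarrow> real"
  assumes "\<And>t. t \<in> A \<Longrightarrow> 0 \<le> f t"
  shows "0 \<le> (LINT t:A|M. f t)"
  unfolding set_lebesgue_integral_def
  by (rule Bochner_Integration.integral_nonneg) (use assms in \<open>simp add: indicator_def\<close>)

lemma set_integrable_powr_Ioc:
  fixes p c :: real
  assumes "p > -1" "c \<ge> 0"
  shows "set_integrable lborel {0<..c} (\<lambda>t. t powr p)"
proof -
  have "(\<lambda>t. t powr p) absolutely_integrable_on {0<..c}"
    by (rule nonnegative_absolutely_integrable_1[OF integrable_on_powr_from_0'[OF assms]]) auto
  then show ?thesis
    unfolding set_integrable_def by (subst (asm) integrable_completion) auto
qed

lemma
  fixes p c :: real
  assumes "p < -1" "c > 0"
  shows set_integrable_powr_Ioi: "set_integrable lborel {c<..} (\<lambda>t. t powr p)"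
    and set_integral_powr_Ioi: "(LBINT t:{c<..}. t powr p) = - (c powr (p + 1)) / (p + 1)"
proof -
  note has_integral = has_integral_powr_to_inf[OF assms]
  have "(\<lambda>t. t powr p) absolutely_integrable_on {c..}"
    by (rule nonnegative_absolutely_integrable_1) (use has_integral in auto)
  then have Ici: "set_integrable lborel {c..} (\<lambda>t. t powr p)"
    unfolding set_integrable_def by (subst (asm) integrable_completion) auto
  then show Ioi: "set_integrable lborel {c<..} (\<lambda>t. t powr p)"
    by (rule set_integrable_subset) auto
  show "(LBINT t:{c<..}. t powr p) = - (c powr (p + 1)) / (p + 1)"
    using set_borel_integral_eq_integral(2)[OF Ici] integral_unique[OF has_integral]
    by (simp flip: set_integral_Ici_eq_Ioi[OF Ioi])
qed

lemma
  fixes c B :: real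
  assumes "c > 0"
  shows set_integrable_inverse_square_Ioi: "set_integrable lborel {c<..} (\<lambda>t. B / t\<^sup>2)"
    and set_integral_inverse_square_Ioi: "(LBINT t:{c<..}. B / t\<^sup>2) = B / c"
proof -
  have powr_eq: "B / t\<^sup>2 = B * t powr (-2)" if "t \<in> {c<..}" for t
    using that assms by (simp add: powr_minus powr_numeral field_simps)
  have "set_integrable lborel {c<..} (\<lambda>t. B * t powr (-2))"
    using assms by (intro set_integrable_mult_right set_integrable_powr_Ioi) simp_all
  then show "set_integrable lborel {c<..} (\<lambda>t. B / t\<^sup>2)"
    by (subst set_integrable_cong[OF refl refl powr_eq])
  have "(LBINT t:{c<..}. B / t\<^sup>2) = (LBINT t:{c<..}. B * t powr (-2))"
    by (rule set_lebesgue_integral_cong) (use powr_eq in auto)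
  also have "\<dots> = B * (LBINT t:{c<..}. t powr (-2))" by (rule set_integral_mult_right)
  also have "\<dots> = B / c"
    by (subst set_integral_powr_Ioi) (use assms in \<open>simp_all add: powr_minus_divide\<close>)
  finally show "(LBINT t:{c<..}. B / t\<^sup>2) = B / c" .
qed

definition tail_envelope :: "real \<Rightarrow> real \<Rightarrow> real \<Rightarrow> real \<Rightarrow> real" where
  "tail_envelope c A B t = (if t \<le> c then A else B / t\<^sup>2)"

lemma
  fixes c A B :: real
  assumes "0 < c"
  shows set_integrable_tail_envelope: "set_integrable lborel {0<..} (tail_envelope c A B)"
    and set_integral_tail_envelope: "(LBINT t:{0<..}. tail_envelope c A B t) = A * c + B / c"
proof -
  have split: "{0<..} = {0<..c} \<union> {c<..}" using assms by (simp add: ivl_disj_un)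
  have "set_integrable lborel {0<..c} (\<lambda>t. A)"
    by (rule set_integrable_subset[of _ "{0..c}"]) (auto intro: borel_integrable_atLeastAtMost')
  then have near: "set_integrable lborel {0<..c} (tail_envelope c A B)"
    by (subst set_integrable_cong[OF refl refl, of _ _ "\<lambda>t. A"]) (auto simp: tail_envelope_def)
  have far: "set_integrable lborel {c<..} (tail_envelope c A B)"
    using set_integrable_inverse_square_Ioi[OF assms, of B]
    by (subst set_integrable_cong[OF refl refl, of _ _ "\<lambda>t. B / t\<^sup>2"]) (auto simp: tail_envelope_def)
  show "set_integrable lborel {0<..} (tail_envelope c A B)"
    unfolding split by (rule set_integrable_Un[OF near far]) auto
  have "(LBINT t:{0<..}. tail_envelope c A B t)
      = (LBINT t:{0<..c}. tail_envelope c A B t) + (LBINT t:{c<..}. tail_envelope c A B t)"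
    unfolding split by (rule set_integral_Un[OF _ near far]) auto
  also have "(LBINT t:{0<..c}. tail_envelope c A B t) = (LBINT t:{0<..c}. A)"
    by (rule set_lebesgue_integral_cong) (auto simp: tail_envelope_def)
  also have "\<dots> = A * c" using assms by (simp add: set_lebesgue_integral_def)
  also have "(LBINT t:{c<..}. tail_envelope c A B t) = (LBINT t:{c<..}. B / t\<^sup>2)"
    by (rule set_lebesgue_integral_cong) (auto simp: tail_envelope_def)
  also have "\<dots> = B / c" by (rule set_integral_inverse_square_Ioi[OF assms])
  finally show "(LBINT t:{0<..}. tail_envelope c A B t) = A * c + B / c" .
qed

lemma abs_ln_le_powr:
  fixes t :: real
  assumes "0 < t"
  shows "\<bar>ln t\<bar> \<le> t + 2 * t powr (-1/2)"
proof -
  have "- ln t = 2 * ln (t powr (-1/2))" using assms by (simp add: ln_powr)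
  also have "\<dots> \<le> 2 * t powr (-1/2)" using ln_less_self[of "t powr (-1/2)"] assms by simp
  finally have "- ln t \<le> 2 * t powr (-1/2)" .
  moreover have "0 \<le> t powr (-1/2)" by simp
  ultimately show ?thesis using ln_less_self[OF assms] assms by linarith
qed

lemma set_integrable_ln_abs_Icc:
  fixes a b c :: real
  shows "set_integrable lborel {a..b} (\<lambda>t. ln \<bar>t + c\<bar>)"
proof -
  define r where "r = \<bar>a\<bar> + \<bar>b\<bar> + \<bar>c\<bar>"
  have "set_integrable lborel {0<..r} (\<lambda>t. t + 2 * t powr (-1/2))"
    by (intro set_integral_add set_integrable_mult_right set_integrable_powr_Ioc
          set_integrable_subset[OF borel_integrable_atLeastAtMost'[of 0 r]])
      (auto simp: r_def)
  then have "set_integrable lborel {0<..r} (\<lambda>t. ln t)"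
  proof (rule set_integrable_continuous_dominated)
    show "\<bar>ln t\<bar> \<le> t + 2 * t powr (-1/2)" if "t \<in> {0<..r}" for t
      using abs_ln_le_powr[of t] that by simp
  qed (auto intro!: continuous_intros)
  then have "set_integrable lborel {0<..} (\<lambda>t. indicator {-r..r} t * ln \<bar>t\<bar>)"
    unfolding set_integrable_def
    by (rule Bochner_Integration.integrable_cong[THEN iffD1, rotated 2]) (auto simp: indicator_def)
  then have "integrable lborel (\<lambda>t. indicator {-r..r} t * ln \<bar>t\<bar>)"
    by (rule integrable_even_if_set_integrable_Ioi) (auto simp: indicator_def)
  from lborel_integrable_real_affine[OF this, of 1 c]
  have "integrable lborel (\<lambda>t. indicator {-r..r} (c + t) * ln \<bar>c + t\<bar>)" by simp
  also have "(\<lambda>t. indicator {-r..r} (c + t) * ln \<bar>c + t\<bar>)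
      = (\<lambda>t. indicator {-r - c..r - c} t *\<^sub>R ln \<bar>t + c\<bar>)"
    by (intro ext) (simp add: indicator_def add.commute le_diff_eq diff_le_eq)
  finally have "set_integrable lborel {-r - c..r - c} (\<lambda>t. ln \<bar>t + c\<bar>)"
    by (simp add: set_integrable_def)
  then show ?thesis by (rule set_integrable_subset) (auto simp: r_def)
qed

lemma set_integrable_ln_abs_mult_Icc:
  fixes a b c :: real
  assumes "continuous_on {a..b} h"
  shows "set_integrable lborel {a..b} (\<lambda>t. ln \<bar>t + c\<bar> * h t)"
proof -
  have "bounded (h ` {a..b})"
    using compact_continuous_image[OF assms] by (simp add: compact_imp_bounded)
  then obtain B where "\<forall>y\<in>h ` {a..b}. norm y \<le> B" unfolding bounded_iff by blast
  then have B: "\<bar>h t\<bar> \<le> B" if "t \<in> {a..b}" for t using that by simp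
  show ?thesis
  proof (rule set_integrable_bound[OF set_integrable_mult_right[OF set_integrable_ln_abs_Icc]])
    have "(\<lambda>t. (indicator {a..b} t *\<^sub>R ln \<bar>t + c\<bar>) * (indicator {a..b} t *\<^sub>R h t))
        \<in> borel_measurable lborel"
      using set_integrable_ln_abs_Icc[of a b c] set_borel_measurable_continuous_on[OF _ assms]
      by (intro borel_measurable_times) (simp_all add: set_integrable_def set_borel_measurable_def)
    also have "(\<lambda>t. (indicator {a..b} t *\<^sub>R ln \<bar>t + c\<bar>) * (indicator {a..b} t *\<^sub>R h t))
        = (\<lambda>t. indicator {a..b} t *\<^sub>R (ln \<bar>t + c\<bar> * h t))"
      by (auto simp: indicator_def)
    finally show "set_borel_measurable lborel {a..b} (\<lambda>t. ln \<bar>t + c\<bar> * h t)"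
      by (simp add: set_borel_measurable_def)
    have "\<bar>ln \<bar>t + c\<bar> * h t\<bar> \<le> \<bar>B * ln \<bar>t + c\<bar>\<bar>" if "t \<in> {a..b}" for t
      using mult_left_mono[OF order.trans[OF B[OF that] abs_ge_self], of "\<bar>ln \<bar>t + c\<bar>\<bar>"]
      by (simp add: abs_mult mult.commute)
    then show "AE t in lborel. t \<in> {a..b} \<longrightarrow> norm (ln \<bar>t + c\<bar> * h t) \<le> norm (B * ln \<bar>t + c\<bar>)"
      by simp
  qed
qed

definition primitive :: "(real \<Rightarrow> real) \<Rightarrow> real \<Rightarrow> real" where
  "primitive f x = (LBINT t=0..x. f t)"

lemma primitive_0 [simp]: "primitive f 0 = 0"
  by (simp add: primitive_def zero_ereal_def)

lemma primitive_has_real_derivative: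
  assumes "continuous_on UNIV f"
  shows "(primitive f has_real_derivative f x) (at x)"
proof -
  have "((\<lambda>u. LBINT t=ereal 0..u. f t) has_vector_derivative f x) (at x within {-\<bar>x\<bar> - 1..\<bar>x\<bar> + 1})"
    by (rule interval_integral_FTC2) (use assms in \<open>auto intro: continuous_on_subset\<close>)
  moreover have "at x within {-\<bar>x\<bar> - 1..\<bar>x\<bar> + 1} = at x"
    by (rule at_within_interior) (simp add: abs_if)
  ultimately show ?thesis
    by (simp add: has_real_derivative_iff_has_vector_derivative primitive_def[abs_def] zero_ereal_def)
qed

section \<open>Hoelder classes\<close>

definition hoelder_on :: "real \<Rightarrow> 'a::metric_space set \<Rightarrow> ('a \<Rightarrow> 'b::real_normed_vector) \<Rightarrow> bool" where
  "hoelder_on \<alpha> S f \<longleftrightarrow>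
     bounded (f ` S) \<and> (\<exists>C. \<forall>x\<in>S. \<forall>y\<in>S. norm (f x - f y) \<le> C * dist x y powr \<alpha>)"

lemma hoelder_onI:
  assumes "bounded (f ` S)" "\<And>x y. x \<in> S \<Longrightarrow> y \<in> S \<Longrightarrow> norm (f x - f y) \<le> C * dist x y powr \<alpha>"
  shows "hoelder_on \<alpha> S f"
  using assms unfolding hoelder_on_def by blast

lemma hoelder_on_imp_bounded: "hoelder_on \<alpha> S f \<Longrightarrow> bounded (f ` S)"
  by (simp add: hoelder_on_def)

lemma hoelder_onE:
  assumes "hoelder_on \<alpha> S f"
  obtains C where "0 \<le> C" "\<And>x. x \<in> S \<Longrightarrow> norm (f x) \<le> C"
    "\<And>x y. x \<in> S \<Longrightarrow> y \<in> S \<Longrightarrow> norm (f x - f y) \<le> C * dist x y powr \<alpha>"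
proof -
  obtain B where B: "\<forall>y\<in>f ` S. norm y \<le> B"
    using hoelder_on_imp_bounded[OF assms] unfolding bounded_iff by blast
  obtain C where C: "norm (f x - f y) \<le> C * dist x y powr \<alpha>" if "x \<in> S" "y \<in> S" for x y
    using assms unfolding hoelder_on_def by blast
  show thesis
  proof (rule that[of "max 0 (max B C)"])
    show "norm (f x) \<le> max 0 (max B C)" if "x \<in> S" for x using B that by fastforce
    show "norm (f x - f y) \<le> max 0 (max B C) * dist x y powr \<alpha>" if "x \<in> S" "y \<in> S" for x y
      by (rule order.trans[OF C[OF that]]) (intro mult_right_mono, auto)
  qed simp
qed

lemma hoelder_on_smaller_exponent:
  assumes "hoelder_on \<alpha> S f" "0 < \<beta>" "\<beta> \<le> \<alpha>"
  shows "hoelder_on \<beta> S f"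
proof -
  obtain C where C: "0 \<le> C" "\<And>x. x \<in> S \<Longrightarrow> norm (f x) \<le> C"
    "\<And>x y. x \<in> S \<Longrightarrow> y \<in> S \<Longrightarrow> norm (f x - f y) \<le> C * dist x y powr \<alpha>"
    using hoelder_onE[OF assms(1)] by metis
  show ?thesis
  proof (rule hoelder_onI[OF hoelder_on_imp_bounded[OF assms(1)]])
    fix x y assume xy: "x \<in> S" "y \<in> S"
    show "norm (f x - f y) \<le> 2 * C * dist x y powr \<beta>"
    proof (cases "dist x y \<le> 1")
      case True
      have "norm (f x - f y) \<le> C * dist x y powr \<alpha>" by (rule C(3)[OF xy])
      also have "\<dots> \<le> C * dist x y powr \<beta>"
        using C(1) True assms by (intro mult_left_mono powr_mono') auto
      also have "\<dots> \<le> 2 * C * dist x y powr \<beta>" using C(1) by (intro mult_right_mono) auto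
      finally show ?thesis .
    next
      case False
      have "norm (f x - f y) \<le> 2 * C * 1"
        using norm_triangle_ineq4[of "f x" "f y"] C(2)[OF xy(1)] C(2)[OF xy(2)] by simp
      also have "\<dots> \<le> 2 * C * dist x y powr \<beta>"
        using C(1) False assms by (intro mult_left_mono ge_one_powr_ge_zero) auto
      finally show ?thesis .
    qed
  qed
qed

lemma hoelder_on_add:
  assumes "hoelder_on \<alpha> S f" "hoelder_on \<alpha> S g"
  shows "hoelder_on \<alpha> S (\<lambda>x. f x + g x)"
proof -
  obtain C where C: "\<And>x y. x \<in> S \<Longrightarrow> y \<in> S \<Longrightarrow> norm (f x - f y) \<le> C * dist x y powr \<alpha>"
    using hoelder_onE[OF assms(1)] by metis
  obtain D where D: "\<And>x y. x \<in> S \<Longrightarrow> y \<in> S \<Longrightarrow> norm (g x - g y) \<le> D * dist x y powr \<alpha>"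
    using hoelder_onE[OF assms(2)] by metis
  show ?thesis
  proof (rule hoelder_onI[OF bounded_plus_comp])
    fix x y assume "x \<in> S" "y \<in> S"
    then have "norm (f x + g x - (f y + g y)) \<le> C * dist x y powr \<alpha> + D * dist x y powr \<alpha>"
      using norm_diff_triangle_ineq[of "f x" "g x" "f y" "g y"] C D by (meson add_mono order.trans)
    then show "norm (f x + g x - (f y + g y)) \<le> (C + D) * dist x y powr \<alpha>"
      by (simp add: distrib_right)
  qed (use assms in \<open>simp_all add: hoelder_on_imp_bounded\<close>)
qed

lemma hoelder_on_mult:
  fixes f g :: "'a::metric_space \<Rightarrow> 'b::real_normed_algebra"
  assumes "hoelder_on \<alpha> S f" "hoelder_on \<alpha> S g"
  shows "hoelder_on \<alpha> S (\<lambda>x. f x * g x)"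
proof -
  obtain C where C: "0 \<le> C" "\<And>x. x \<in> S \<Longrightarrow> norm (f x) \<le> C"
    "\<And>x y. x \<in> S \<Longrightarrow> y \<in> S \<Longrightarrow> norm (f x - f y) \<le> C * dist x y powr \<alpha>"
    using hoelder_onE[OF assms(1)] by metis
  obtain D where D: "0 \<le> D" "\<And>x. x \<in> S \<Longrightarrow> norm (g x) \<le> D"
    "\<And>x y. x \<in> S \<Longrightarrow> y \<in> S \<Longrightarrow> norm (g x - g y) \<le> D * dist x y powr \<alpha>"
    using hoelder_onE[OF assms(2)] by metis
  have norm_mult_le: "norm (u * v) \<le> A * B" if "norm u \<le> A" "norm v \<le> B" "0 \<le> A" for u v :: 'b and A B
    by (rule order.trans[OF norm_mult_ineq mult_mono]) (use that in auto)
  show ?thesis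
  proof (rule hoelder_onI)
    show "bounded ((\<lambda>x. f x * g x) ` S)"
      unfolding bounded_iff using norm_mult_le[OF C(2) D(2)] C(1) by blast
    fix x y assume xy: "x \<in> S" "y \<in> S"
    have "f x * g x - f y * g y = f x * (g x - g y) + (f x - f y) * g y"
      by (simp add: algebra_simps)
    then have "norm (f x * g x - f y * g y) \<le> norm (f x * (g x - g y)) + norm ((f x - f y) * g y)"
      by (simp add: norm_triangle_ineq)
    also have "\<dots> \<le> C * (D * dist x y powr \<alpha>) + (C * dist x y powr \<alpha>) * D"
      using C(1) by (intro add_mono norm_mult_le C D xy) auto
    also have "\<dots> = (2 * C * D) * dist x y powr \<alpha>" by (simp add: algebra_simps)
    finally show "norm (f x * g x - f y * g y) \<le> (2 * C * D) * dist x y powr \<alpha>" .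
  qed
qed

lemma hoelder_on_const: "hoelder_on \<alpha> S (\<lambda>x. c)"
  by (rule hoelder_onI[where C = 0]) (auto simp: bounded_iff)

lemma hoelder_on_subset: "hoelder_on \<alpha> S f \<Longrightarrow> T \<subseteq> S \<Longrightarrow> hoelder_on \<alpha> T f"
  unfolding hoelder_on_def by (meson bounded_subset image_mono subsetD)

lemma hoelder_on_cong:
  assumes "\<And>x. x \<in> S \<Longrightarrow> f x = g x"
  shows "hoelder_on \<alpha> S f \<longleftrightarrow> hoelder_on \<alpha> S g"
  using assms by (simp add: hoelder_on_def image_cong[OF refl assms])

lemma hoelder_on_shift:
  fixes f :: "'a::real_normed_vector \<Rightarrow> 'b::real_normed_vector"
  assumes "hoelder_on \<alpha> T f" "\<And>x. x \<in> S \<Longrightarrow> x + c \<in> T"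
  shows "hoelder_on \<alpha> S (\<lambda>x. f (x + c))"
proof -
  obtain C where C: "\<And>x. x \<in> T \<Longrightarrow> norm (f x) \<le> C"
    "\<And>x y. x \<in> T \<Longrightarrow> y \<in> T \<Longrightarrow> norm (f x - f y) \<le> C * dist x y powr \<alpha>"
    using hoelder_onE[OF assms(1)] by metis
  show ?thesis
  proof (rule hoelder_onI)
    show "bounded ((\<lambda>x. f (x + c)) ` S)"
      unfolding bounded_iff using C(1) assms(2) by blast
    show "norm (f (x + c) - f (y + c)) \<le> C * dist x y powr \<alpha>" if "x \<in> S" "y \<in> S" for x y
      using C(2)[OF assms(2)[OF that(1)] assms(2)[OF that(2)]] by (simp add: dist_norm)
  qed
qed

lemma hoelder_on_lipschitz: "K-lipschitz_on S f \<Longrightarrow> bounded (f ` S) \<Longrightarrow> hoelder_on 1 S f"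
  by (rule hoelder_onI) (auto dest: lipschitz_onD simp: dist_norm)

lemma hoelder_on_bounded_derivative:
  fixes f :: "real \<Rightarrow> real"
  assumes "convex S" "bounded (f ` S)"
    and der: "\<And>x. x \<in> S \<Longrightarrow> (f has_real_derivative f' x) (at x)" and "bounded (f' ` S)"
  shows "hoelder_on 1 S f"
proof -
  obtain K where "\<forall>y\<in>f' ` S. norm y \<le> K"
    using assms(4) unfolding bounded_iff by blast
  then have K: "norm (f' x) \<le> \<bar>K\<bar>" if "x \<in> S" for x using that by fastforce
  have "\<bar>K\<bar>-lipschitz_on S f"
    by (rule lipschitz_onI)
      (use field_differentiable_bound[OF assms(1) has_field_derivative_at_within[OF der] K]
        in \<open>auto simp: dist_norm\<close>)
  then show ?thesis using assms(2) by (rule hoelder_on_lipschitz)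
qed

lemma hoelder_on_imp_continuous_on:
  assumes "hoelder_on \<alpha> S f" "0 < \<alpha>"
  shows "continuous_on S f"
  unfolding continuous_on_def
proof
  fix x assume x: "x \<in> S"
  obtain C where C: "\<And>x y. x \<in> S \<Longrightarrow> y \<in> S \<Longrightarrow> norm (f x - f y) \<le> C * dist x y powr \<alpha>"
    using hoelder_onE[OF assms(1)] by metis
  have "((\<lambda>y. C * dist y x powr \<alpha>) \<longlongrightarrow> C * dist x x powr \<alpha>) (at x within S)"
    by (intro tendsto_intros) (use assms in auto)
  then have "((\<lambda>y. C * dist y x powr \<alpha>) \<longlongrightarrow> 0) (at x within S)" by simp
  then have "((\<lambda>y. f y - f x) \<longlongrightarrow> 0) (at x within S)"
    by (rule Lim_null_comparison[rotated]) (use C[OF _ x] in \<open>auto simp: eventually_at_filter\<close>)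
  then show "(f \<longlongrightarrow> f x) (at x within S)" by (simp add: LIM_zero_iff)
qed

primrec hoelder_C :: "nat \<Rightarrow> real set \<Rightarrow> (real \<Rightarrow> real) \<Rightarrow> bool" where
  "hoelder_C 0 S f \<longleftrightarrow> (\<exists>\<alpha>>0. hoelder_on \<alpha> S f)"
| "hoelder_C (Suc n) S f \<longleftrightarrow>
     hoelder_C n S f \<and> (\<exists>f'. (\<forall>x\<in>S. (f has_real_derivative f' x) (at x)) \<and> hoelder_C n S f')"

declare hoelder_C.simps(2) [simp del]

lemma hoelder_C_SucI:
  assumes "hoelder_C n S f" "\<And>x. x \<in> S \<Longrightarrow> (f has_real_derivative f' x) (at x)" "hoelder_C n S f'"
  shows "hoelder_C (Suc n) S f"
  using assms by (auto simp: hoelder_C.simps(2))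

lemma hoelder_C_SucE:
  assumes "hoelder_C (Suc n) S f"
  obtains f' where "hoelder_C n S f" "hoelder_C n S f'"
    "\<And>x. x \<in> S \<Longrightarrow> (f has_real_derivative f' x) (at x)"
  using assms by (auto simp: hoelder_C.simps(2))

lemma hoelder_C_mono: "m \<le> n \<Longrightarrow> hoelder_C n S f \<Longrightarrow> hoelder_C m S f"
  by (induction n rule: dec_induct) (auto elim: hoelder_C_SucE)

lemma hoelder_C_imp_hoelder_on:
  assumes "hoelder_C n S f"
  obtains \<alpha> where "0 < \<alpha>" "hoelder_on \<alpha> S f"
  using hoelder_C_mono[OF le0 assms] by auto

lemma hoelder_C_imp_bounded: "hoelder_C n S f \<Longrightarrow> bounded (f ` S)"
  using hoelder_C_imp_hoelder_on hoelder_on_imp_bounded by metis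

lemma hoelder_C_cong:
  assumes "open S" "\<And>x. x \<in> S \<Longrightarrow> f x = g x" "hoelder_C n S f"
  shows "hoelder_C n S g"
  using assms(3)
proof (induction n)
  case 0
  then show ?case using hoelder_on_cong[of S f g] assms(2) by auto
next
  case (Suc n)
  then obtain f' where f': "hoelder_C n S f" "hoelder_C n S f'"
      "\<And>x. x \<in> S \<Longrightarrow> (f has_real_derivative f' x) (at x)"
    using hoelder_C_SucE by metis
  have "(g has_real_derivative f' x) (at x)" if "x \<in> S" for x
    using has_field_derivative_transform_within_open[OF f'(3)[OF that] assms(1) that] assms(2) by auto
  then show ?case using Suc.IH f' by (blast intro: hoelder_C_SucI)
qed

lemma hoelder_C_const: "hoelder_C n S (\<lambda>x. c)"
proof (induction n arbitrary: c)
  case 0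
  show ?case by (auto intro!: exI[of _ 1] hoelder_on_const)
next
  case (Suc n)
  show ?case by (rule hoelder_C_SucI[where f' = "\<lambda>x. 0"]) (use Suc in auto)
qed

lemma hoelder_C_0_common_exponent:
  assumes "hoelder_C 0 S f" "hoelder_C 0 S g"
  obtains \<alpha> where "0 < \<alpha>" "hoelder_on \<alpha> S f" "hoelder_on \<alpha> S g"
proof -
  obtain \<alpha> \<beta> where "0 < \<alpha>" "hoelder_on \<alpha> S f" "0 < \<beta>" "hoelder_on \<beta> S g"
    using assms by auto
  then show thesis
    by (intro that[of "min \<alpha> \<beta>"]) (auto intro: hoelder_on_smaller_exponent)
qed

lemma hoelder_C_add:
  "hoelder_C n S f \<Longrightarrow> hoelder_C n S g \<Longrightarrow> hoelder_C n S (\<lambda>x. f x + g x)"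
proof (induction n arbitrary: f g)
  case 0
  then obtain \<alpha> where "0 < \<alpha>" "hoelder_on \<alpha> S f" "hoelder_on \<alpha> S g"
    by (rule hoelder_C_0_common_exponent)
  then show ?case by (auto intro: hoelder_on_add)
next
  case (Suc n)
  obtain f' where f': "hoelder_C n S f" "hoelder_C n S f'"
      "\<And>x. x \<in> S \<Longrightarrow> (f has_real_derivative f' x) (at x)"
    using hoelder_C_SucE[OF Suc.prems(1)] by blast
  obtain g' where g': "hoelder_C n S g" "hoelder_C n S g'"
      "\<And>x. x \<in> S \<Longrightarrow> (g has_real_derivative g' x) (at x)"
    using hoelder_C_SucE[OF Suc.prems(2)] by blast
  show ?case
    by (rule hoelder_C_SucI[where f' = "\<lambda>x. f' x + g' x"]) (use Suc.IH f' g' in \<open>auto intro: DERIV_add\<close>)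
qed

lemma hoelder_C_mult:
  "hoelder_C n S f \<Longrightarrow> hoelder_C n S g \<Longrightarrow> hoelder_C n S (\<lambda>x. f x * g x)"
proof (induction n arbitrary: f g)
  case 0
  then obtain \<alpha> where "0 < \<alpha>" "hoelder_on \<alpha> S f" "hoelder_on \<alpha> S g"
    by (rule hoelder_C_0_common_exponent)
  then show ?case by (auto intro: hoelder_on_mult)
next
  case (Suc n)
  obtain f' where f': "hoelder_C n S f" "hoelder_C n S f'"
      "\<And>x. x \<in> S \<Longrightarrow> (f has_real_derivative f' x) (at x)"
    using hoelder_C_SucE[OF Suc.prems(1)] by blast
  obtain g' where g': "hoelder_C n S g" "hoelder_C n S g'"
      "\<And>x. x \<in> S \<Longrightarrow> (g has_real_derivative g' x) (at x)"
    using hoelder_C_SucE[OF Suc.prems(2)] by blast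
  show ?case
    by (rule hoelder_C_SucI[where f' = "\<lambda>x. f' x * g x + g' x * f x"])
      (use Suc.IH f' g' in \<open>auto intro: hoelder_C_add DERIV_mult\<close>)
qed

lemma hoelder_C_cmult: "hoelder_C n S f \<Longrightarrow> hoelder_C n S (\<lambda>x. c * f x)"
  using hoelder_C_mult[OF hoelder_C_const] .

lemma hoelder_C_diff:
  assumes "hoelder_C n S f" "hoelder_C n S g"
  shows "hoelder_C n S (\<lambda>x. f x - g x)"
  using hoelder_C_add[OF assms(1) hoelder_C_cmult[OF assms(2), of "-1"]] by simp

lemma hoelder_C_shift:
  assumes "\<And>x. x \<in> S \<Longrightarrow> x + c \<in> T"
  shows "hoelder_C n T f \<Longrightarrow> hoelder_C n S (\<lambda>x. f (x + c))"
proof (induction n arbitrary: f)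
  case 0
  then show ?case using assms by (auto intro: hoelder_on_shift)
next
  case (Suc n)
  obtain f' where f': "hoelder_C n T f" "hoelder_C n T f'"
      "\<And>x. x \<in> T \<Longrightarrow> (f has_real_derivative f' x) (at x)"
    using hoelder_C_SucE[OF Suc.prems] by blast
  show ?case
  proof (rule hoelder_C_SucI[where f' = "\<lambda>x. f' (x + c)"])
    show "((\<lambda>x. f (x + c)) has_real_derivative f' (x + c)) (at x)" if "x \<in> S" for x
      using f'(3)[OF assms[OF that]] by (simp add: DERIV_shift)
  qed (use Suc.IH f' in auto)
qed

lemma hoelder_C_Suc_deriv:
  assumes "open S" "hoelder_C (Suc n) S f"
  shows "hoelder_C n S (deriv f)"
    and "x \<in> S \<Longrightarrow> (f has_real_derivative deriv f x) (at x)"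
proof -
  obtain f' where f': "\<And>x. x \<in> S \<Longrightarrow> (f has_real_derivative f' x) (at x)" "hoelder_C n S f'"
    using hoelder_C_SucE[OF assms(2)] by blast
  then have eq: "f' x = deriv f x" if "x \<in> S" for x
    using DERIV_imp_deriv that by metis
  show "hoelder_C n S (deriv f)" by (rule hoelder_C_cong[OF assms(1) eq f'(2)])
  show "x \<in> S \<Longrightarrow> (f has_real_derivative deriv f x) (at x)" using f'(1) eq by metis
qed

lemma hoelder_C_funpow_deriv:
  assumes "open S"
  shows "hoelder_C (j + n) S f \<Longrightarrow> hoelder_C n S ((deriv ^^ j) f)"
proof (induction j arbitrary: n)
  case (Suc j)
  then have "hoelder_C (Suc n) S ((deriv ^^ j) f)" by simp
  then show ?case using hoelder_C_Suc_deriv(1)[OF assms] by simp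
qed simp

lemma has_real_derivative_funpow_deriv:
  assumes "open S" "\<And>n. hoelder_C n S f" "x \<in> S"
  shows "((deriv ^^ j) f has_real_derivative (deriv ^^ Suc j) f x) (at x)"
  using hoelder_C_Suc_deriv(2)[OF assms(1) hoelder_C_funpow_deriv[OF assms(1,2)] assms(3)] by simp

lemma smooth_on_set_if_hoelder_C:
  assumes "\<And>x. x \<in> S \<Longrightarrow> \<exists>U. open U \<and> x \<in> U \<and> (\<forall>n. hoelder_C n U f)"
  shows "smooth_on_set S f"
  unfolding smooth_on_set_def
proof (intro exI[of _ "\<lambda>n. (deriv ^^ n) f"] conjI allI ballI)
  fix n x assume "x \<in> S"
  then obtain U where "open U" "x \<in> U" "\<And>n. hoelder_C n U f" using assms by blast
  then show "((deriv ^^ n) f has_real_derivative (deriv ^^ Suc n) f x) (at x)"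
    by (intro has_real_derivative_funpow_deriv)
qed simp

section \<open>The local part of the Hilbert transform\<close>

definition symmetric_quotient :: "(real \<Rightarrow> real) \<Rightarrow> real \<Rightarrow> real \<Rightarrow> real" where
  "symmetric_quotient f x t = (f (x - t) - f (x + t)) / t"

definition near_hilbert :: "real \<Rightarrow> (real \<Rightarrow> real) \<Rightarrow> real \<Rightarrow> real" where
  "near_hilbert d f x = (LBINT t:{0<..d}. symmetric_quotient f x t)"

lemma has_real_derivative_symmetric_quotient:
  assumes "(f has_real_derivative f' (x - t)) (at (x - t))"
    and "(f has_real_derivative f' (x + t)) (at (x + t))"
  shows "((\<lambda>x. symmetric_quotient f x t) has_real_derivative symmetric_quotient f' x t) (at x)"
proof -
  have "((\<lambda>x. f (x - t)) has_real_derivative f' (x - t)) (at x)"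
    using assms(1) DERIV_shift[of f _ x "- t"] by simp
  moreover have "((\<lambda>x. f (x + t)) has_real_derivative f' (x + t)) (at x)"
    using assms(2) by (simp add: DERIV_shift)
  ultimately show ?thesis
    unfolding symmetric_quotient_def by (intro DERIV_cdivide DERIV_diff)
qed

context
  fixes S T :: "real set" and d :: real
  assumes translate: "\<And>x t. x \<in> S \<Longrightarrow> \<bar>t\<bar> \<le> d \<Longrightarrow> x + t \<in> T" and d: "d > 0"
begin

lemma translate_both:
  assumes "x \<in> S" "t \<in> {0<..d}"
  shows "x - t \<in> T" "x + t \<in> T"
  using translate[of x t] translate[of x "- t"] assms by auto

lemma symmetric_quotient_bound:
  assumes "0 < \<alpha>" "\<And>x y. x \<in> T \<Longrightarrow> y \<in> T \<Longrightarrow> norm (f x - f y) \<le> C * dist x y powr \<alpha>"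
    and "x \<in> S" "t \<in> {0<..d}"
  shows "\<bar>symmetric_quotient f x t\<bar> \<le> 2 powr \<alpha> * C * t powr (\<alpha> - 1)"
proof -
  have "\<bar>f (x - t) - f (x + t)\<bar> \<le> C * dist (x - t) (x + t) powr \<alpha>"
    using assms(2) translate_both[OF assms(3,4)] by (simp only: real_norm_def)
  also have "dist (x - t) (x + t) = 2 * t" using assms(4) by (simp add: dist_real_def)
  finally have "\<bar>f (x - t) - f (x + t)\<bar> / t \<le> C * (2 * t) powr \<alpha> / t"
    using assms(4) by (intro divide_right_mono) auto
  then show ?thesis
    using assms(4) by (simp add: symmetric_quotient_def abs_divide powr_mult powr_diff mult_ac)
qed

lemma set_integrable_symmetric_quotient:
  assumes "0 < \<alpha>" "hoelder_on \<alpha> T f" "x \<in> S"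
  shows "set_integrable lborel {0<..d} (symmetric_quotient f x)"
proof -
  obtain C where C: "\<And>x y. x \<in> T \<Longrightarrow> y \<in> T \<Longrightarrow> norm (f x - f y) \<le> C * dist x y powr \<alpha>"
    using hoelder_onE[OF assms(2)] by metis
  show ?thesis
  proof (rule set_integrable_continuous_dominated)
    show "set_integrable lborel {0<..d} (\<lambda>t. 2 powr \<alpha> * C * t powr (\<alpha> - 1))"
      using assms(1) d by (intro set_integrable_mult_right set_integrable_powr_Ioc) auto
    show "continuous_on {0<..d} (symmetric_quotient f x)"
      unfolding symmetric_quotient_def
      by (intro continuous_intros continuous_on_compose2[OF hoelder_on_imp_continuous_on[OF assms(2,1)]]
          image_subsetI translate_both assms(3)) auto
  qed (use symmetric_quotient_bound[OF assms(1) C assms(3)] in auto)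
qed

(* Geometric mean of the two bounds that the Hoelder condition gives in t and in x. *)
lemma symmetric_quotient_diff_bound:
  assumes "0 < \<alpha>" "0 \<le> C" and C: "\<And>x y. x \<in> T \<Longrightarrow> y \<in> T \<Longrightarrow> norm (f x - f y) \<le> C * dist x y powr \<alpha>"
    and x: "x \<in> S" and y: "y \<in> S" and t: "t \<in> {0<..d}"
  defines "A \<equiv> 2 * 2 powr \<alpha> * C"
  shows "\<bar>symmetric_quotient f x t - symmetric_quotient f y t\<bar>
    \<le> dist x y powr (\<alpha> / 2) * (A * t powr (\<alpha> / 2 - 1))"
proof (rule power2_le_imp_le)
  let ?e = "\<bar>symmetric_quotient f x t - symmetric_quotient f y t\<bar>"
  have in_t: "?e \<le> A * t powr (\<alpha> - 1)"
    using symmetric_quotient_bound[OF assms(1) C x t] symmetric_quotient_bound[OF assms(1) C y t]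
    by (simp add: A_def)
  have "\<bar>(f (x - t) - f (x + t)) - (f (y - t) - f (y + t))\<bar>
      \<le> C * dist (x - t) (y - t) powr \<alpha> + C * dist (x + t) (y + t) powr \<alpha>"
    using C[OF translate_both(1)[OF x t] translate_both(1)[OF y t]]
      C[OF translate_both(2)[OF x t] translate_both(2)[OF y t]] by simp
  also have "\<dots> = 2 * C * dist x y powr \<alpha>" by (simp add: dist_real_def)
  also have "\<dots> \<le> A * dist x y powr \<alpha>"
    using assms(1,2) ge_one_powr_ge_zero[of 2 \<alpha>] mult_right_mono[of 1 "2 powr \<alpha>" C]
    by (intro mult_right_mono) (auto simp: A_def mult_ac)
  finally have "\<bar>(f (x - t) - f (x + t)) - (f (y - t) - f (y + t))\<bar> / t \<le> A * dist x y powr \<alpha> / t"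
    using t by (intro divide_right_mono) auto
  then have in_xy: "?e \<le> A * dist x y powr \<alpha> * t powr -1"
    using t by (simp add: symmetric_quotient_def abs_divide powr_minus_divide flip: diff_divide_distrib)
  have "?e * ?e \<le> (A * t powr (\<alpha> - 1)) * (A * dist x y powr \<alpha> * t powr -1)"
    using assms(2) by (intro mult_mono in_t in_xy) (auto simp: A_def)
  also have "\<dots> = (A * (dist x y powr (\<alpha> / 2)) * t powr (\<alpha> / 2 - 1))\<^sup>2"
  proof -
    have "t powr (\<alpha> - 1) * t powr -1 = t powr (\<alpha> / 2 - 1) * t powr (\<alpha> / 2 - 1)"
      by (simp only: powr_add[symmetric]) simp
    moreover have "dist x y powr \<alpha> = (dist x y powr (\<alpha> / 2))\<^sup>2"
      by (simp add: power2_eq_square flip: powr_add)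
    ultimately show ?thesis by algebra
  qed
  finally show "?e\<^sup>2 \<le> (dist x y powr (\<alpha> / 2) * (A * t powr (\<alpha> / 2 - 1)))\<^sup>2"
    by (simp add: power2_eq_square mult_ac)
qed (use assms(2) in \<open>simp add: A_def\<close>)

lemma hoelder_on_near_hilbert:
  assumes "0 < \<alpha>" and f: "hoelder_on \<alpha> T f"
  shows "hoelder_on (\<alpha> / 2) S (near_hilbert d f)"
proof -
  obtain C where C: "0 \<le> C" "\<And>x y. x \<in> T \<Longrightarrow> y \<in> T \<Longrightarrow> norm (f x - f y) \<le> C * dist x y powr \<alpha>"
    using hoelder_onE[OF f] by metis
  define A where "A = 2 * 2 powr \<alpha> * C"
  note integrable = set_integrable_symmetric_quotient[OF assms]
  have powr_integrable: "set_integrable lborel {0<..d} (\<lambda>t. c * t powr (\<beta> - 1))" if "0 < \<beta>" for c \<beta>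
    using that d by (intro set_integrable_mult_right set_integrable_powr_Ioc) auto
  show ?thesis
  proof (rule hoelder_onI)
    have "\<bar>near_hilbert d f x\<bar> \<le> (LBINT t:{0<..d}. 2 powr \<alpha> * C * t powr (\<alpha> - 1))" if x: "x \<in> S" for x
      unfolding near_hilbert_def
      by (rule set_integral_abs_le[OF integrable[OF x] powr_integrable[OF assms(1)]
            symmetric_quotient_bound[OF assms(1) C(2) x]])
    then show "bounded (near_hilbert d f ` S)" unfolding bounded_iff by auto
    fix x y assume xy: "x \<in> S" "y \<in> S"
    have "\<bar>near_hilbert d f x - near_hilbert d f y\<bar>
        = \<bar>LBINT t:{0<..d}. symmetric_quotient f x t - symmetric_quotient f y t\<bar>"
      by (simp add: near_hilbert_def set_integral_diff integrable xy)
    also have "\<dots> \<le> (LBINT t:{0<..d}. dist x y powr (\<alpha> / 2) * (A * t powr (\<alpha> / 2 - 1)))"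
      unfolding A_def
      by (intro set_integral_abs_le set_integral_diff integrable xy set_integrable_mult_right
          powr_integrable symmetric_quotient_diff_bound C) (use assms in auto)
    finally show "norm (near_hilbert d f x - near_hilbert d f y)
        \<le> (LBINT t:{0<..d}. A * t powr (\<alpha> / 2 - 1)) * dist x y powr (\<alpha> / 2)"
      by (simp add: mult.commute)
  qed
qed

lemma has_real_derivative_near_hilbert:
  assumes "open S" and f: "0 < \<beta>" "hoelder_on \<beta> T f" and f': "0 < \<alpha>" "hoelder_on \<alpha> T f'"
    and der: "\<And>x. x \<in> T \<Longrightarrow> (f has_real_derivative f' x) (at x)" and x: "x \<in> S"
  shows "(near_hilbert d f has_real_derivative near_hilbert d f' x) (at x)"
proof -
  obtain C where C: "\<And>x y. x \<in> T \<Longrightarrow> y \<in> T \<Longrightarrow> norm (f' x - f' y) \<le> C * dist x y powr \<alpha>"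
    using hoelder_onE[OF f'(2)] by metis
  obtain e where e: "e > 0" "\<And>y. \<bar>y - x\<bar> < e \<Longrightarrow> y \<in> S"
    using openE[OF assms(1) x] by (auto simp: ball_def dist_real_def subset_iff abs_minus_commute)
  show ?thesis
    unfolding near_hilbert_def
  proof (rule has_real_derivative_set_integral_dominated[OF e(1)])
    show "set_integrable lborel {0<..d} (symmetric_quotient f y)" if "\<bar>y - x\<bar> < e" for y
      by (rule set_integrable_symmetric_quotient[OF f e(2)[OF that]])
    show "set_integrable lborel {0<..d} (\<lambda>t. 2 powr \<alpha> * C * t powr (\<alpha> - 1))"
      using f'(1) d by (intro set_integrable_mult_right set_integrable_powr_Ioc) auto
    fix y t assume y: "\<bar>y - x\<bar> < e" and t: "t \<in> {0<..d}"
    show "\<bar>symmetric_quotient f' y t\<bar> \<le> 2 powr \<alpha> * C * t powr (\<alpha> - 1)"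
      by (rule symmetric_quotient_bound[OF f'(1) C e(2)[OF y] t])
    show "((\<lambda>y. symmetric_quotient f y t) has_real_derivative symmetric_quotient f' y t) (at y)"
      by (intro has_real_derivative_symmetric_quotient der translate_both e(2)[OF y] t)
  qed
qed

lemma hoelder_C_near_hilbert:
  assumes "open S"
  shows "hoelder_C n T f \<Longrightarrow> hoelder_C n S (near_hilbert d f)"
proof (induction n arbitrary: f)
  case 0
  then obtain \<alpha> where "0 < \<alpha>" "hoelder_on \<alpha> T f" by auto
  then show ?case using hoelder_on_near_hilbert by (auto intro!: exI[of _ "\<alpha> / 2"])
next
  case (Suc n)
  obtain f' where f': "hoelder_C n T f" "hoelder_C n T f'"
      "\<And>x. x \<in> T \<Longrightarrow> (f has_real_derivative f' x) (at x)"
    using hoelder_C_SucE[OF Suc.prems] by blast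
  obtain \<beta> \<alpha> where "0 < \<beta>" "hoelder_on \<beta> T f" "0 < \<alpha>" "hoelder_on \<alpha> T f'"
    using hoelder_C_imp_hoelder_on f'(1,2) by metis
  then have "(near_hilbert d f has_real_derivative near_hilbert d f' x) (at x)" if "x \<in> S" for x
    by (rule has_real_derivative_near_hilbert[OF assms _ _ _ _ f'(3) that])
  then show ?case by (rule hoelder_C_SucI[OF Suc.IH[OF f'(1)] _ Suc.IH[OF f'(2)]])
qed

end

section \<open>The Hilbert transform of an even function with decaying slope\<close>

definition hilbert :: "(real \<Rightarrow> real) \<Rightarrow> real \<Rightarrow> real" where
  "hilbert f x = (LBINT t:{0<..}. symmetric_quotient f x t)"

definition parity_sum :: "nat \<Rightarrow> (real \<Rightarrow> real) \<Rightarrow> real \<Rightarrow> real \<Rightarrow> real" where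
  "parity_sum m f x t = f (x - t) + (-1) ^ m * f (x + t)"

definition far_hilbert :: "nat \<Rightarrow> real \<Rightarrow> (real \<Rightarrow> real) \<Rightarrow> real \<Rightarrow> real" where
  "far_hilbert m d f x = (LBINT t:{d<..}. parity_sum m f x t / t ^ m)"

lemma parity_sum_1_divide: "parity_sum 1 f x t / t ^ 1 = symmetric_quotient f x t"
  by (simp add: parity_sum_def symmetric_quotient_def)

lemma abs_parity_sum_le: "\<bar>parity_sum m f x t\<bar> \<le> \<bar>f (x - t)\<bar> + \<bar>f (x + t)\<bar>"
  unfolding parity_sum_def by (cases "even m") auto

lemma continuous_on_parity_sum:
  assumes "continuous_on UNIV f"
  shows "continuous_on A (parity_sum m f x)"
  unfolding parity_sum_def
  by (intro continuous_intros continuous_on_compose2[OF assms]) auto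

lemma has_real_derivative_parity_sum:
  assumes "\<And>x. (f has_real_derivative f' x) (at x)"
  shows "((\<lambda>x. parity_sum m f x t) has_real_derivative parity_sum m f' x t) (at x)"
    and "((\<lambda>t. parity_sum m f x t) has_real_derivative - parity_sum (Suc m) f' x t) (at t)"
  unfolding parity_sum_def by (auto intro!: derivative_eq_intros DERIV_chain2[OF assms])

lemma one_divide_power_le:
  fixes t d :: real
  assumes "0 < d" "d < t" "2 \<le> n"
  shows "1 / t ^ n \<le> 1 / d ^ (n - 2) / t\<^sup>2"
proof -
  have "t ^ n = t ^ (n - 2) * t\<^sup>2" using assms(3) by (metis le_add_diff_inverse2 power_add)
  moreover have "d ^ (n - 2) * t\<^sup>2 \<le> t ^ (n - 2) * t\<^sup>2"
    using assms by (intro mult_right_mono power_mono) auto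
  ultimately have "1 / t ^ n \<le> 1 / (d ^ (n - 2) * t\<^sup>2)"
    using assms by (intro divide_left_mono) auto
  then show ?thesis by simp
qed

locale even_log_lipschitz =
  fixes f :: "real \<Rightarrow> real" and K L :: real
  assumes even: "f (- x) = f x"
    and abs_le: "\<bar>f x\<bar> \<le> K"
    and log_lipschitz: "0 \<le> x \<Longrightarrow> x \<le> y \<Longrightarrow> \<bar>f x - f y\<bar> \<le> L * (y - x) / (1 + x)"
begin

lemma f_abs: "f \<bar>x\<bar> = f x"
  using even[of x] by (simp add: abs_if)

lemma K_nonneg: "0 \<le> K"
  using abs_le[of 0] by simp

lemma L_nonneg: "0 \<le> L"
  using log_lipschitz[of 0 1] by simp

lemma abs_diff_le_nonneg:
  assumes "0 \<le> x" "x \<le> y"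
  shows "\<bar>f x - f y\<bar> \<le> L * (y - x)"
proof -
  have "L * (y - x) / (1 + x) \<le> L * (y - x) / 1"
    using assms L_nonneg by (intro divide_left_mono) auto
  then show ?thesis using log_lipschitz[OF assms] by simp
qed

lemma lipschitz: "L-lipschitz_on UNIV f"
proof (rule lipschitz_onI[OF _ L_nonneg])
  fix x y :: real
  have "\<bar>f \<bar>x\<bar> - f \<bar>y\<bar>\<bar> \<le> L * \<bar>\<bar>x\<bar> - \<bar>y\<bar>\<bar>"
    using abs_diff_le_nonneg[of "\<bar>x\<bar>" "\<bar>y\<bar>"] abs_diff_le_nonneg[of "\<bar>y\<bar>" "\<bar>x\<bar>"]
    by (cases "\<bar>x\<bar> \<le> \<bar>y\<bar>") (auto simp: abs_minus_commute)
  also have "\<dots> \<le> L * \<bar>x - y\<bar>"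
    by (intro mult_left_mono abs_triangle_ineq3 L_nonneg)
  finally show "dist (f x) (f y) \<le> L * dist x y" by (simp add: f_abs dist_real_def)
qed

lemma continuous: "continuous_on A f"
  by (rule lipschitz_on_continuous_on[OF lipschitz_on_subset[OF lipschitz]]) simp

lemma continuous_on_compose_f [continuous_intros]:
  "continuous_on A g \<Longrightarrow> continuous_on A (\<lambda>t. f (g t))"
  by (rule continuous_on_compose2[OF continuous]) auto

lemma tendsto_at_right_f: "(f \<longlongrightarrow> f x) (at_right x)"
  using continuous[of UNIV] by (simp add: continuous_on_def filterlim_at_split)

lemma hoelder_on_f: "hoelder_on 1 A f"
  by (rule hoelder_on_subset[OF hoelder_on_lipschitz[OF lipschitz]])
    (use abs_le in \<open>auto simp: bounded_iff\<close>)

lemma abs_symmetric_difference_le: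
  "\<bar>f (x - t) - f (x + t)\<bar> \<le> 2 * L * min \<bar>x\<bar> \<bar>t\<bar> / (1 + \<bar>\<bar>x\<bar> - \<bar>t\<bar>\<bar>)"
proof -
  define u v where "u = \<bar>\<bar>x\<bar> - \<bar>t\<bar>\<bar>" and "v = \<bar>x\<bar> + \<bar>t\<bar>"
  have "\<bar>x - t\<bar> = u \<and> \<bar>x + t\<bar> = v \<or> \<bar>x - t\<bar> = v \<and> \<bar>x + t\<bar> = u"
    unfolding u_def v_def by linarith
  then have "\<bar>f (x - t) - f (x + t)\<bar> = \<bar>f u - f v\<bar>"
    by (metis f_abs abs_minus_commute)
  also have "\<dots> \<le> L * (v - u) / (1 + u)"
    by (rule log_lipschitz) (auto simp: u_def v_def)
  also have "v - u = 2 * min \<bar>x\<bar> \<bar>t\<bar>" by (auto simp: u_def v_def min_def)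
  finally show ?thesis by (simp add: u_def mult_ac)
qed

lemma abs_symmetric_difference_far_le:
  assumes "\<bar>x\<bar> \<le> X" "2 * X \<le> t" "0 < t"
  shows "\<bar>f (x - t) - f (x + t)\<bar> \<le> 4 * L * X / t"
proof -
  have "\<bar>f (x - t) - f (x + t)\<bar> \<le> 2 * L * \<bar>x\<bar> / (1 + (t - \<bar>x\<bar>))"
    using abs_symmetric_difference_le[of x t] assms by (simp add: min_def split: if_splits)
  also have "\<dots> \<le> 2 * L * X / (t / 2)"
    using assms L_nonneg by (intro frac_le mult_left_mono) auto
  finally show ?thesis by simp
qed

lemma abs_symmetric_quotient_far_le:
  assumes "\<bar>x\<bar> \<le> X" "2 * X \<le> t" "0 < t"
  shows "\<bar>symmetric_quotient f x t\<bar> \<le> 4 * L * X / t\<^sup>2"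
  using divide_right_mono[OF abs_symmetric_difference_far_le[OF assms], of t] assms(3)
  by (simp add: symmetric_quotient_def power2_eq_square)

lemma abs_symmetric_quotient_le_envelope:
  assumes "\<bar>x\<bar> \<le> X" "t \<in> {0<..}"
  shows "\<bar>symmetric_quotient f x t\<bar> \<le> tail_envelope (2 * X) (2 * L) (4 * L * X) t"
proof (cases "t \<le> 2 * X")
  case True
  have "\<bar>f (x - t) - f (x + t)\<bar> \<le> L * \<bar>(x - t) - (x + t)\<bar>"
    using lipschitz_onD[OF lipschitz, of "x - t" "x + t"] by (simp add: dist_real_def)
  then show ?thesis
    using True assms by (simp add: tail_envelope_def symmetric_quotient_def abs_divide divide_le_eq)
next
  case False
  then show ?thesis
    using assms abs_symmetric_quotient_far_le[of x X t] by (simp add: tail_envelope_def)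
qed

(* Sharper than the previous envelope for large x: its integral does not depend on x. *)
lemma abs_symmetric_quotient_le_scaled_envelope:
  assumes "0 < x" "t \<in> {0<..}"
  shows "\<bar>symmetric_quotient f x t\<bar> \<le> tail_envelope (2 * x) (4 * (K + L) / x) (4 * L * x) t"
proof -
  have "\<bar>f (x - t) - f (x + t)\<bar> \<le> 4 * (K + L) / x * t" if t: "0 < t" "t \<le> 2 * x"
  proof (cases "2 * t \<le> x")
    case True
    have "\<bar>f (x - t) - f (x + t)\<bar> \<le> 2 * L * t / (1 + (x - t))"
      using abs_symmetric_difference_le[of x t] True t by (simp add: min_def split: if_splits)
    also have "\<dots> \<le> 2 * L * t / (x / 2)"
      using True t L_nonneg by (intro divide_left_mono mult_pos_pos) auto
    also have "\<dots> \<le> 4 * (K + L) * t / x"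
      using t K_nonneg assms by (simp add: divide_right_mono mult_right_mono)
    finally show ?thesis by simp
  next
    case False
    have "\<bar>f (x - t) - f (x + t)\<bar> \<le> 2 * K"
      using abs_le[of "x - t"] abs_le[of "x + t"] by linarith
    also have "\<dots> \<le> 4 * K / x * t"
      using False assms mult_left_mono[of x "2 * t" "2 * K"] K_nonneg by (simp add: field_simps)
    also have "\<dots> \<le> 4 * (K + L) / x * t"
      using t L_nonneg assms by (simp add: divide_right_mono mult_right_mono)
    finally show ?thesis .
  qed
  then show ?thesis
    using assms abs_symmetric_quotient_far_le[of x x t]
    by (auto simp: tail_envelope_def symmetric_quotient_def abs_divide pos_divide_le_eq)
qed

lemma set_integrable_symmetric_quotient_Ioi: "set_integrable lborel {0<..} (symmetric_quotient f x)"
proof (rule set_integrable_continuous_dominated)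
  show "set_integrable lborel {0<..} (tail_envelope (2 * (\<bar>x\<bar> + 1)) (2 * L) (4 * L * (\<bar>x\<bar> + 1)))"
    by (rule set_integrable_tail_envelope) simp
  show "continuous_on {0<..} (symmetric_quotient f x)"
    unfolding symmetric_quotient_def by (intro continuous_intros) auto
  show "\<bar>symmetric_quotient f x t\<bar> \<le> tail_envelope (2 * (\<bar>x\<bar> + 1)) (2 * L) (4 * L * (\<bar>x\<bar> + 1)) t"
    if "t \<in> {0<..}" for t
    by (rule abs_symmetric_quotient_le_envelope[OF _ that]) simp
qed simp

lemma hilbert_minus: "hilbert f (- x) = - hilbert f x"
proof -
  have "symmetric_quotient f (- x) t = - symmetric_quotient f x t" for t
    using even[of "x + t"] even[of "x - t"] by (simp add: symmetric_quotient_def diff_divide_distrib)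
  then show ?thesis
    by (simp add: hilbert_def set_integral_uminus[OF set_integrable_symmetric_quotient_Ioi])
qed

lemma abs_hilbert_le_pos:
  assumes "x > 0"
  shows "\<bar>hilbert f x\<bar> \<le> 8 * K + 10 * L"
proof -
  have "\<bar>hilbert f x\<bar> \<le> (LBINT t:{0<..}. tail_envelope (2 * x) (4 * (K + L) / x) (4 * L * x) t)"
    unfolding hilbert_def
    by (intro set_integral_abs_le set_integrable_symmetric_quotient_Ioi set_integrable_tail_envelope
        abs_symmetric_quotient_le_scaled_envelope) (use assms in auto)
  also have "\<dots> = 8 * K + 10 * L"
    using assms by (simp add: set_integral_tail_envelope)
  finally show ?thesis .
qed

lemma abs_hilbert_le: "\<bar>hilbert f x\<bar> \<le> 8 * K + 10 * L"
proof -
  consider "x > 0" | "x = 0" | "- x > 0" by linarith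
  then show ?thesis
  proof cases
    case 2
    then show ?thesis using hilbert_minus[of 0] K_nonneg L_nonneg by simp
  qed (use abs_hilbert_le_pos[of x] abs_hilbert_le_pos[of "- x"] hilbert_minus[of x] in auto)
qed

lemma hilbert_split:
  assumes "0 < d"
  shows "hilbert f x = near_hilbert d f x + far_hilbert 1 d f x"
proof -
  have "set_integrable lborel {0<..d} (symmetric_quotient f x)"
    and "set_integrable lborel {d<..} (symmetric_quotient f x)"
    by (rule set_integrable_subset[OF set_integrable_symmetric_quotient_Ioi]; use assms in auto)+
  then have "(LBINT t:{0<..d} \<union> {d<..}. symmetric_quotient f x t)
      = near_hilbert d f x + (LBINT t:{d<..}. symmetric_quotient f x t)"
    by (subst set_integral_Un) (auto simp: near_hilbert_def)
  moreover have "{0<..d} \<union> {d<..} = {0<..}" using assms by auto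
  ultimately show ?thesis
    unfolding hilbert_def far_hilbert_def parity_sum_1_divide by simp
qed

abbreviation F :: "real \<Rightarrow> real" where
  "F \<equiv> primitive f"

lemmas F_deriv = primitive_has_real_derivative[OF continuous]

lemma continuous_F: "continuous_on A F"
  by (rule DERIV_continuous_on[OF has_field_derivative_at_within[OF F_deriv]])

lemma continuous_on_compose_F [continuous_intros]:
  "continuous_on A g \<Longrightarrow> continuous_on A (\<lambda>t. F (g t))"
  by (rule continuous_on_compose2[OF continuous_F]) auto

lemma F_minus: "F (- x) = - F x"
proof -
  have "((\<lambda>x. F x + F (- x)) has_real_derivative 0) (at x)" for x
    by (auto intro!: derivative_eq_intros F_deriv DERIV_chain2[OF F_deriv] simp: even)
  then have "F x + F (- x) = F 0 + F (- 0)"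
    using DERIV_isconst_all[of "\<lambda>x. F x + F (- x)" x 0] by blast
  then show ?thesis by simp
qed

lemma abs_F_diff_le: "\<bar>F x - F y\<bar> \<le> K * \<bar>x - y\<bar>"
  using field_differentiable_bound[of UNIV F f K x y] F_deriv abs_le by auto

lemma abs_F_le: "\<bar>F x\<bar> \<le> K * \<bar>x\<bar>"
  using abs_F_diff_le[of x 0] by simp

subsection \<open>Differentiating the tail\<close>

lemma abs_parity_sum_f_le: "\<bar>parity_sum m f x t\<bar> \<le> 2 * K"
  using abs_parity_sum_le[of m f x t] abs_le[of "x - t"] abs_le[of "x + t"] by linarith

lemma abs_far_integrand_le:
  assumes "0 < d" "2 \<le> m" "t \<in> {d<..}"
  shows "\<bar>parity_sum m f x t / t ^ m\<bar> \<le> 2 * K / d ^ (m - 2) / t\<^sup>2"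
proof -
  have "\<bar>parity_sum m f x t / t ^ m\<bar> \<le> 2 * K * (1 / t ^ m)"
    using abs_parity_sum_f_le assms by (simp add: abs_divide divide_right_mono)
  also have "\<dots> \<le> 2 * K * (1 / d ^ (m - 2) / t\<^sup>2)"
    using assms K_nonneg by (intro mult_left_mono one_divide_power_le) auto
  finally show ?thesis by simp
qed

lemma set_integrable_far_integrand:
  assumes "0 < d" "1 \<le> m"
  shows "set_integrable lborel {d<..} (\<lambda>t. parity_sum m f x t / t ^ m)"
proof (cases "m = 1")
  case True
  have "set_integrable lborel {d<..} (symmetric_quotient f x)"
    by (rule set_integrable_subset[OF set_integrable_symmetric_quotient_Ioi]) (use assms in auto)
  then show ?thesis unfolding True parity_sum_1_divide .
next
  case False
  then have "2 \<le> m" using assms by simp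
  show ?thesis
  proof (rule set_integrable_continuous_dominated[OF set_integrable_inverse_square_Ioi[OF assms(1)] _ _
        abs_far_integrand_le[OF assms(1) \<open>2 \<le> m\<close>]])
    show "continuous_on {d<..} (\<lambda>t. parity_sum m f x t / t ^ m)"
      using assms(1) by (intro continuous_intros continuous_on_parity_sum continuous) auto
  qed simp
qed

lemma abs_parity_sum_F_le:
  assumes "0 < d" "1 \<le> m"
  obtains C where "\<And>t. t \<in> {d<..} \<Longrightarrow> \<bar>parity_sum (Suc m) F x t / t ^ Suc m\<bar> \<le> C / t\<^sup>2"
proof (cases "m = 1")
  case True
  have "\<bar>parity_sum 2 F x t\<bar> \<le> 2 * K * \<bar>x\<bar>" for t
    using abs_F_diff_le[of "x + t" "t - x"] F_minus[of "t - x"] by (simp add: parity_sum_def mult_ac)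
  then show ?thesis
    using True assms
    by (intro that[of "2 * K * \<bar>x\<bar>"]) (simp add: abs_divide divide_right_mono numeral_2_eq_2)
next
  case False
  have "\<bar>parity_sum (Suc m) F x t / t ^ Suc m\<bar> \<le> 2 * K * (\<bar>x\<bar> / d + 1) / d ^ (m - 2) / t\<^sup>2"
    if t: "t \<in> {d<..}" for t
  proof -
    have "\<bar>parity_sum (Suc m) F x t\<bar> \<le> K * \<bar>x - t\<bar> + K * \<bar>x + t\<bar>"
      using abs_parity_sum_le[of "Suc m" F x t] abs_F_le[of "x - t"] abs_F_le[of "x + t"] by linarith
    also have "\<dots> = K * (\<bar>x - t\<bar> + \<bar>x + t\<bar>)" by (simp add: distrib_left)
    also have "\<dots> \<le> K * (2 * (\<bar>x\<bar> + t))"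
      using t assms K_nonneg by (intro mult_left_mono) auto
    also have "\<dots> = K * (2 * (\<bar>x\<bar> / t + 1) * t)"
      using t assms by (simp add: field_simps)
    also have "\<dots> \<le> K * (2 * (\<bar>x\<bar> / d + 1) * t)"
      using t assms K_nonneg
      by (intro mult_left_mono mult_right_mono add_right_mono divide_left_mono) auto
    finally have "\<bar>parity_sum (Suc m) F x t\<bar> / t ^ Suc m \<le> K * (2 * (\<bar>x\<bar> / d + 1) * t) / t ^ Suc m"
      using t assms by (intro divide_right_mono) auto
    also have "\<dots> = 2 * K * (\<bar>x\<bar> / d + 1) * (1 / t ^ m)" using t assms by simp
    also have "\<dots> \<le> 2 * K * (\<bar>x\<bar> / d + 1) * (1 / d ^ (m - 2) / t\<^sup>2)"
      using t assms False K_nonneg by (intro mult_left_mono one_divide_power_le) auto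
    finally show ?thesis using t assms by (simp add: abs_divide)
  qed
  then show ?thesis by (rule that)
qed

lemma set_integrable_parity_sum_F:
  assumes "0 < d" "1 \<le> m"
  shows "set_integrable lborel {d<..} (\<lambda>t. parity_sum (Suc m) F x t / t ^ Suc m)"
proof -
  obtain C where C: "\<And>t. t \<in> {d<..} \<Longrightarrow> \<bar>parity_sum (Suc m) F x t / t ^ Suc m\<bar> \<le> C / t\<^sup>2"
    using abs_parity_sum_F_le[OF assms] by metis
  show ?thesis
    using assms(1)
    by (intro set_integrable_continuous_dominated[OF set_integrable_inverse_square_Ioi _ _ C])
      (auto intro!: continuous_intros continuous_on_parity_sum continuous_F simp del: power_Suc)
qed

lemma parity_sum_F_tendsto_0:
  fixes d :: real
  assumes "0 < d" "1 \<le> m"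
  shows "((\<lambda>t. parity_sum (Suc m) F x t / t ^ m) \<longlongrightarrow> 0) at_top"
proof -
  obtain C where C: "\<And>t. t \<in> {d<..} \<Longrightarrow> \<bar>parity_sum (Suc m) F x t / t ^ Suc m\<bar> \<le> C / t\<^sup>2"
    using abs_parity_sum_F_le[OF assms] by metis
  have "((\<lambda>t. C / t) \<longlongrightarrow> 0) at_top" by real_asymp
  moreover have "\<forall>\<^sub>F t in at_top. norm (parity_sum (Suc m) F x t / t ^ m) \<le> C / t"
  proof (rule eventually_mono[OF eventually_gt_at_top[of d]])
    fix t assume t: "d < t"
    have "\<bar>parity_sum (Suc m) F x t / t ^ Suc m\<bar> * t \<le> C / t\<^sup>2 * t"
      by (intro mult_right_mono C) (use assms t in auto)
    then show "norm (parity_sum (Suc m) F x t / t ^ m) \<le> C / t"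
      using t assms by (simp add: abs_divide power2_eq_square)
  qed
  ultimately show ?thesis by (rule Lim_null_comparison[rotated])
qed

lemma has_real_derivative_parity_sum_F_divide:
  assumes "1 \<le> m" "0 < t"
  shows "((\<lambda>t. parity_sum (Suc m) F x t / t ^ m) has_real_derivative
    - (parity_sum m f x t / t ^ m) - m * (parity_sum (Suc m) F x t / t ^ Suc m)) (at t)"
proof -
  obtain k where k: "m = Suc k" using assms(1) by (cases m) auto
  show ?thesis
    by (rule DERIV_cong[OF DERIV_divide[OF has_real_derivative_parity_sum(2)[OF F_deriv] DERIV_pow]])
      (use assms(2) in \<open>auto simp: k parity_sum_def field_simps\<close>)
qed

(* f need not be differentiable, but once F has replaced f one can differentiate in x under the integral. *)
lemma far_hilbert_by_parts:
  assumes d: "0 < d" and m: "1 \<le> m"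
  shows "far_hilbert m d f x
    = parity_sum (Suc m) F x d / d ^ m - m * (LBINT t:{d<..}. parity_sum (Suc m) F x t / t ^ Suc m)"
proof -
  let ?F = "\<lambda>t. parity_sum (Suc m) F x t / t ^ m"
  let ?f = "\<lambda>t. - (parity_sum m f x t / t ^ m) - m * (parity_sum (Suc m) F x t / t ^ Suc m)"
  note deriv = has_real_derivative_parity_sum_F_divide[OF m]
  have integrable_uminus: "set_integrable lborel {d<..} (\<lambda>t. - (parity_sum m f x t / t ^ m))"
    using set_integrable_mult_right[OF set_integrable_far_integrand[OF d m], of "- 1"]
    by (simp only: mult_minus1)
  have integrable_F: "set_integrable lborel {d<..} (\<lambda>t. m * (parity_sum (Suc m) F x t / t ^ Suc m))"
    by (intro set_integrable_mult_right set_integrable_parity_sum_F d m)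
  have "(LBINT t=ereal d..\<infinity>. ?f t) = 0 - ?F d"
  proof (rule interval_integral_FTC_integrable)
    fix t assume "ereal d < ereal t"
    then have t: "t > 0" using d by simp
    show "(?F has_vector_derivative ?f t) (at t)"
      using deriv[OF t] by (simp add: has_real_derivative_iff_has_vector_derivative)
    have "continuous_on {0<..} ?f"
      by (intro continuous_intros continuous_on_parity_sum continuous continuous_F) auto
    then show "isCont ?f t" using t by (simp add: continuous_on_eq_continuous_at)
  next
    show "set_integrable lborel (einterval (ereal d) \<infinity>) ?f"
      using set_integral_diff(1)[OF integrable_uminus integrable_F] by simp
    have "(?F \<longlongrightarrow> ?F d) (at_right d)"
      using DERIV_isCont[OF deriv[OF d]] by (simp add: continuous_at filterlim_at_split)
    then show "((?F \<circ> real_of_ereal) \<longlongrightarrow> ?F d) (at_right (ereal d))"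
      by (simp add: ereal_tendsto_simps)
    show "((?F \<circ> real_of_ereal) \<longlongrightarrow> 0) (at_left \<infinity>)"
      using parity_sum_F_tendsto_0[OF d m] by (simp add: ereal_tendsto_simps)
  qed simp
  moreover have "(LBINT t:{d<..}. ?f t)
      = - far_hilbert m d f x - m * (LBINT t:{d<..}. parity_sum (Suc m) F x t / t ^ Suc m)"
    unfolding set_integral_diff(2)[OF integrable_uminus integrable_F] far_hilbert_def
      set_integral_uminus[OF set_integrable_far_integrand[OF d m]] set_integral_mult_right ..
  ultimately show ?thesis by (simp add: interval_integral_to_infinity_eq)
qed

lemma has_real_derivative_far_hilbert:
  assumes d: "0 < d" and m: "1 \<le> m"
  shows "(far_hilbert m d f has_real_derivative
    parity_sum (Suc m) f x d / d ^ m - m * far_hilbert (Suc m) d f x) (at x)"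
proof -
  have "((\<lambda>x. LBINT t:{d<..}. parity_sum (Suc m) F x t / t ^ Suc m) has_real_derivative
      far_hilbert (Suc m) d f x) (at x)"
    unfolding far_hilbert_def
  proof (rule has_real_derivative_set_integral_dominated[OF zero_less_one])
    show "set_integrable lborel {d<..} (\<lambda>t. 2 * K / d ^ (Suc m - 2) / t\<^sup>2)"
      by (rule set_integrable_inverse_square_Ioi[OF d])
    show "\<bar>parity_sum (Suc m) f y t / t ^ Suc m\<bar> \<le> 2 * K / d ^ (Suc m - 2) / t\<^sup>2" if "t \<in> {d<..}" for y t
      by (rule abs_far_integrand_le[OF d]) (use m that in auto)
  qed (intro set_integrable_parity_sum_F[OF d m] DERIV_cdivide has_real_derivative_parity_sum F_deriv)+
  then have "((\<lambda>x. parity_sum (Suc m) F x d / d ^ m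
        - m * (LBINT t:{d<..}. parity_sum (Suc m) F x t / t ^ Suc m))
      has_real_derivative parity_sum (Suc m) f x d / d ^ m - m * far_hilbert (Suc m) d f x) (at x)"
    by (intro DERIV_diff DERIV_cmult DERIV_cdivide has_real_derivative_parity_sum F_deriv)
  then show ?thesis by (simp only: far_hilbert_by_parts[OF d m, abs_def] eta_contract_eq)
qed

lemma bounded_far_hilbert:
  assumes d: "0 < d" and m: "1 \<le> m"
  shows "bounded (range (far_hilbert m d f))"
proof (cases "m = 1")
  case True
  have "bounded (range (near_hilbert d f))"
    using hoelder_on_near_hilbert[of UNIV d UNIV, OF _ d zero_less_one hoelder_on_f]
    by (simp add: hoelder_on_imp_bounded)
  moreover have "bounded (range (hilbert f))"
    using abs_hilbert_le by (auto simp: bounded_iff)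
  moreover have "far_hilbert 1 d f = (\<lambda>x. hilbert f x - near_hilbert d f x)"
    using hilbert_split[OF d] by auto
  ultimately show ?thesis unfolding True by (simp only: bounded_minus_comp)
next
  case False
  then have m2: "2 \<le> m" using m by simp
  have "\<bar>far_hilbert m d f x\<bar> \<le> (LBINT t:{d<..}. 2 * K / d ^ (m - 2) / t\<^sup>2)" for x
    unfolding far_hilbert_def
    by (rule set_integral_abs_le[OF set_integrable_far_integrand[OF d m]
          set_integrable_inverse_square_Ioi[OF d] abs_far_integrand_le[OF d m2]])
  then show ?thesis unfolding bounded_iff by auto
qed

lemma hoelder_on_far_hilbert:
  assumes d: "0 < d" and m: "1 \<le> m"
  shows "hoelder_on 1 UNIV (far_hilbert m d f)"
proof (rule hoelder_on_bounded_derivative[OF convex_UNIV bounded_far_hilbert[OF assms]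
      has_real_derivative_far_hilbert[OF assms]])
  have "bounded (range (\<lambda>x. (1 / d ^ m) *\<^sub>R parity_sum (Suc m) f x d))"
    by (rule bounded_scaleR_comp) (use abs_parity_sum_f_le in \<open>auto simp: bounded_iff\<close>)
  moreover have "bounded (range (\<lambda>x. real m *\<^sub>R far_hilbert (Suc m) d f x))"
    by (rule bounded_scaleR_comp[OF bounded_far_hilbert[OF d]]) simp
  ultimately have "bounded (range (\<lambda>x. (1 / d ^ m) *\<^sub>R parity_sum (Suc m) f x d
      - real m *\<^sub>R far_hilbert (Suc m) d f x))"
    by (rule bounded_minus_comp)
  then show "bounded (range (\<lambda>x. parity_sum (Suc m) f x d / d ^ m - m * far_hilbert (Suc m) d f x))"
    by simp
qed

context
  fixes S T :: "real set" and d :: real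
  assumes translate: "\<And>x t. x \<in> S \<Longrightarrow> \<bar>t\<bar> \<le> d \<Longrightarrow> x + t \<in> T" and d: "d > 0" and S_open: "open S"
begin

lemma hoelder_C_far_hilbert:
  assumes "hoelder_C n T f"
  shows "j \<le> n \<Longrightarrow> 1 \<le> m \<Longrightarrow> hoelder_C j S (far_hilbert m d f)"
proof (induction j arbitrary: m)
  case 0
  then have "hoelder_on 1 S (far_hilbert m d f)"
    using hoelder_on_subset[OF hoelder_on_far_hilbert[OF d]] by blast
  then show ?case by (auto intro!: exI[of _ 1])
next
  case (Suc j)
  have f_j: "hoelder_C j T f" by (rule hoelder_C_mono[OF _ assms]) (use Suc.prems in simp)
  have "hoelder_C j S (\<lambda>x. f (x + - d))" "hoelder_C j S (\<lambda>x. f (x + d))"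
    by (rule hoelder_C_shift[OF translate f_j]; use d in simp)+
  then have "hoelder_C j S (\<lambda>x. 1 / d ^ m * (f (x + - d) + (-1) ^ Suc m * f (x + d))
      - real m * far_hilbert (Suc m) d f x)"
    using Suc by (intro hoelder_C_diff hoelder_C_cmult hoelder_C_add) auto
  then show ?case
    using Suc by (intro hoelder_C_SucI[OF _ has_real_derivative_far_hilbert[OF d]])
      (auto simp: parity_sum_def)
qed

lemma hoelder_C_hilbert:
  assumes "hoelder_C n T f"
  shows "hoelder_C n S (hilbert f)"
proof (rule hoelder_C_cong[OF S_open hilbert_split[OF d, symmetric]])
  show "hoelder_C n S (\<lambda>x. near_hilbert d f x + far_hilbert 1 d f x)"
    by (intro hoelder_C_add hoelder_C_near_hilbert[OF translate d S_open assms]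
        hoelder_C_far_hilbert[OF assms]) simp_all
qed

end

subsection \<open>A lower bound for monotone profiles\<close>

definition excess :: "real \<Rightarrow> real" where
  "excess x = F x - x * f x"

lemma integral_reflected_excess:
  assumes "x > 0"
  shows "(LBINT t:{0<..x}. (f (x - t) - f x) / x) = excess x / x"
proof -
  have "(LBINT t=ereal 0..ereal x. (f (x - t) - f x) / x)
      = (- F (x - x) - f x * x) / x - (- F (x - 0) - f x * 0) / x"
    using assms
    by (intro interval_integral_FTC_finite continuous_intros)
      (auto intro!: derivative_eq_intros DERIV_chain2[OF F_deriv]
        simp flip: has_real_derivative_iff_has_vector_derivative)
  then show ?thesis
    using assms by (simp add: interval_integral_Ioc excess_def diff_divide_distrib mult.commute)
qed

lemma hilbert_ge_excess:
  assumes antimono: "\<And>s t. 0 \<le> s \<Longrightarrow> s \<le> t \<Longrightarrow> f t \<le> f s" and x: "x > 0"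
  shows "excess x / x \<le> hilbert f x"
proof -
  have "excess x / x = (LBINT t:{0<..x}. (f (x - t) - f x) / x)"
    by (rule integral_reflected_excess[OF x, symmetric])
  also have "\<dots> \<le> near_hilbert x f x"
    unfolding near_hilbert_def
  proof (rule set_integral_mono)
    show "set_integrable lborel {0<..x} (\<lambda>t. (f (x - t) - f x) / x)"
      by (rule set_integrable_subset[of _ "{0..x}"])
        (use x in \<open>auto intro!: borel_integrable_atLeastAtMost' continuous_intros\<close>)
    show "set_integrable lborel {0<..x} (symmetric_quotient f x)"
      by (rule set_integrable_subset[OF set_integrable_symmetric_quotient_Ioi]) auto
    show "(f (x - t) - f x) / x \<le> symmetric_quotient f x t" if "t \<in> {0<..x}" for t
      unfolding symmetric_quotient_def
      using that antimono[of "x - t" x] antimono[of x "x + t"] by (intro frac_le) auto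
  qed
  also have "\<dots> \<le> near_hilbert x f x + far_hilbert 1 x f x"
  proof -
    have "0 \<le> symmetric_quotient f x t" if "t \<in> {x<..}" for t
      unfolding symmetric_quotient_def
      using that x antimono[of "\<bar>x - t\<bar>" "x + t"] f_abs[of "x - t"] by (intro divide_nonneg_pos) auto
    then have "0 \<le> (LBINT t:{x<..}. symmetric_quotient f x t)" by (rule set_integral_nonneg)
    then show ?thesis unfolding far_hilbert_def parity_sum_1_divide by simp
  qed
  also have "\<dots> = hilbert f x" by (rule hilbert_split[OF x, symmetric])
  finally show ?thesis .
qed

end

section \<open>The logarithmic potential\<close>

definition log_kernel :: "real \<Rightarrow> real \<Rightarrow> real" where
  "log_kernel x y = ln \<bar>(x\<^sup>2 - y\<^sup>2) / y\<^sup>2\<bar>"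

lemma log_kernel_split:
  assumes "0 \<le> x" "0 < y" "y \<noteq> x"
  shows "log_kernel x y = ln \<bar>y - x\<bar> + ln \<bar>y + x\<bar> - 2 * ln \<bar>y\<bar>"
proof -
  have "x\<^sup>2 - y\<^sup>2 = (x - y) * (y + x)" by (simp add: power2_eq_square algebra_simps)
  then have "\<bar>(x\<^sup>2 - y\<^sup>2) / y\<^sup>2\<bar> = \<bar>y - x\<bar> * \<bar>y + x\<bar> / y\<^sup>2"
    by (simp add: abs_mult abs_divide abs_minus_commute[of y x])
  then show ?thesis
    using assms by (simp add: log_kernel_def ln_div ln_mult ln_realpow)
qed

lemma abs_log_kernel_le:
  assumes "0 \<le> x" "2 * x \<le> y" "0 < y"
  shows "\<bar>log_kernel x y\<bar> \<le> 2 * x\<^sup>2 / y\<^sup>2"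
proof -
  define u where "u = x\<^sup>2 / y\<^sup>2"
  have "(2 * x)\<^sup>2 \<le> y\<^sup>2" using assms by (intro power_mono) auto
  then have "4 * x\<^sup>2 \<le> y\<^sup>2" by (simp add: power_mult_distrib)
  then have "2 * x\<^sup>2 \<le> y\<^sup>2" using zero_le_power2[of x] by linarith
  then have u: "0 \<le> u" "u \<le> 1 / 2" using assms by (auto simp: u_def field_simps)
  have "- u - 2 * u\<^sup>2 \<le> ln (1 - u)" using u by (rule ln_one_minus_pos_lower_bound)
  moreover have "u\<^sup>2 \<le> u * (1 / 2)"
    using mult_left_mono[OF u(2,1)] by (simp add: power2_eq_square)
  moreover have "ln (1 - u) \<le> 0" using u by simp
  ultimately have "\<bar>ln (1 - u)\<bar> \<le> 2 * u" by linarith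
  moreover have "\<bar>(x\<^sup>2 - y\<^sup>2) / y\<^sup>2\<bar> = 1 - u"
  proof -
    have "(x\<^sup>2 - y\<^sup>2) / y\<^sup>2 = - (1 - u)" using assms(3) by (simp add: u_def diff_divide_distrib)
    then show ?thesis using u by (simp only: abs_minus_cancel)
  qed
  ultimately show ?thesis by (simp add: log_kernel_def u_def)
qed

context even_log_lipschitz
begin

(* The integral of f (s - t) - f (s + t) over s in [0, x]. *)
definition difference_primitive :: "real \<Rightarrow> real \<Rightarrow> real" where
  "difference_primitive x t = F (x - t) - F (x + t) + 2 * F t"

definition second_difference :: "real \<Rightarrow> real \<Rightarrow> real" where
  "second_difference x t = f (x + t) + f (x - t) - 2 * f t"

definition potential :: "real \<Rightarrow> real" where
  "potential x = (LBINT t:{0<..}. difference_primitive x t / t)"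

lemma difference_primitive_minus: "difference_primitive (- x) t = difference_primitive x t"
  using F_minus[of "x + t"] F_minus[of "x - t"] by (simp add: difference_primitive_def)

lemma has_real_derivative_difference_primitive:
  shows "((\<lambda>x. difference_primitive x t) has_real_derivative f (x - t) - f (x + t)) (at x)"
    and "(difference_primitive x has_real_derivative - second_difference x t) (at t)"
  unfolding difference_primitive_def[abs_def] second_difference_def
  by (auto intro!: derivative_eq_intros DERIV_chain2[OF F_deriv])

lemma abs_difference_primitive_le:
  assumes "\<And>s. \<bar>s\<bar> \<le> \<bar>x\<bar> \<Longrightarrow> \<bar>f (s - t) - f (s + t)\<bar> \<le> M"
  shows "\<bar>difference_primitive x t\<bar> \<le> M * \<bar>x\<bar>"
proof -
  have "norm (difference_primitive x t - difference_primitive 0 t) \<le> M * norm (x - 0)"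
  proof (rule field_differentiable_bound[of "closed_segment 0 x"])
    show "norm (f (s - t) - f (s + t)) \<le> M" if "s \<in> closed_segment 0 x" for s
      using assms[of s] that by (auto simp: closed_segment_eq_real_ivl split: if_splits)
  qed (auto intro: has_real_derivative_difference_primitive has_field_derivative_at_within)
  then show ?thesis by (simp add: difference_primitive_def F_minus)
qed

lemma continuous_on_difference_primitive: "continuous_on A (difference_primitive x)"
  unfolding difference_primitive_def by (intro continuous_intros)

lemma set_integrable_potential: "set_integrable lborel {0<..} (\<lambda>t. difference_primitive x t / t)"
proof (rule set_integrable_continuous_dominated)
  let ?env = "tail_envelope (2 * (\<bar>x\<bar> + 1)) (2 * L) (4 * L * (\<bar>x\<bar> + 1))"
  show "set_integrable lborel {0<..} (\<lambda>t. \<bar>x\<bar> * ?env t)"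
    by (intro set_integrable_mult_right set_integrable_tail_envelope) simp
  show "continuous_on {0<..} (\<lambda>t. difference_primitive x t / t)"
    by (intro continuous_intros continuous_on_difference_primitive) auto
  fix t :: real assume t: "t \<in> {0<..}"
  have "\<bar>f (s - t) - f (s + t)\<bar> \<le> ?env t * t" if "\<bar>s\<bar> \<le> \<bar>x\<bar>" for s
    using abs_symmetric_quotient_le_envelope[of s "\<bar>x\<bar> + 1" t] that t
    by (simp add: symmetric_quotient_def abs_divide pos_divide_le_eq)
  from abs_difference_primitive_le[OF this]
  show "\<bar>difference_primitive x t / t\<bar> \<le> \<bar>x\<bar> * ?env t"
    using t by (simp add: abs_divide pos_divide_le_eq mult_ac)
qed simp

lemma potential_has_real_derivative: "(potential has_real_derivative hilbert f x) (at x)"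
  unfolding potential_def hilbert_def
proof (rule has_real_derivative_set_integral_dominated[of 1])
  let ?env = "tail_envelope (2 * (\<bar>x\<bar> + 1)) (2 * L) (4 * L * (\<bar>x\<bar> + 1))"
  show "set_integrable lborel {0<..} ?env" by (rule set_integrable_tail_envelope) simp
  show "\<bar>symmetric_quotient f y t\<bar> \<le> ?env t" if "\<bar>y - x\<bar> < 1" "t \<in> {0<..}" for y t
    using that by (intro abs_symmetric_quotient_le_envelope) auto
  show "((\<lambda>x. difference_primitive x t / t) has_real_derivative symmetric_quotient f y t) (at y)" for y t
    unfolding symmetric_quotient_def
    by (intro DERIV_cdivide has_real_derivative_difference_primitive)
qed (simp_all add: set_integrable_potential)

subsection \<open>Integrability of the kernel\<close>

lemma set_integrable_ln_shift: "set_integrable lborel {a..b} (\<lambda>t. ln \<bar>t + c\<bar> * f (g t))"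
  if "continuous_on {a..b} g" for a b c :: real
  by (intro set_integrable_ln_abs_mult_Icc continuous_intros that)

lemma set_integrable_log_kernel_Icc:
  assumes "0 \<le> x"
  shows "set_integrable lborel {0..B} (\<lambda>y. log_kernel x y * f y)"
proof (rule set_integrable_cong_AE[THEN iffD2])
  have [measurable]: "f \<in> borel_measurable borel"
    by (rule borel_measurable_continuous_onI[OF continuous])
  let ?S = "\<lambda>y. ln \<bar>y + (- x)\<bar> * f y + ln \<bar>y + x\<bar> * f y - 2 * (ln \<bar>y + 0\<bar> * f y)"
  show "set_integrable lborel {0..B} ?S"
    by (intro set_integral_add set_integral_diff set_integrable_mult_right set_integrable_ln_shift
        continuous_intros)
  show "(\<lambda>y. log_kernel x y * f y) \<in> borel_measurable lborel" "?S \<in> borel_measurable lborel"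
    unfolding log_kernel_def by measurable
  have "AE y in lborel. y \<noteq> x \<and> y \<noteq> 0" using AE_lborel_singleton AE_conjI by blast
  then show "AE y \<in> {0..B} in lborel. log_kernel x y * f y = ?S y"
    by eventually_elim (use assms in \<open>auto simp: log_kernel_split algebra_simps\<close>)
qed simp

lemma set_integrable_log_kernel:
  assumes "0 \<le> x"
  shows "set_integrable lborel {0<..} (\<lambda>y. log_kernel x y * f y)"
proof -
  define c where "c = 2 * x + 1"
  have c: "0 < c" "2 * x \<le> c" using assms by (auto simp: c_def)
  have "set_integrable lborel {c<..} (\<lambda>y. log_kernel x y * f y)"
  proof (rule set_integrable_continuous_dominated[OF set_integrable_inverse_square_Ioi[OF c(1)]])
    show "continuous_on {c<..} (\<lambda>y. log_kernel x y * f y)"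
      unfolding log_kernel_def using c assms
      by (intro continuous_intros) (auto simp: power2_eq_iff)
    show "\<bar>log_kernel x y * f y\<bar> \<le> 2 * x\<^sup>2 * K / y\<^sup>2" if "y \<in> {c<..}" for y
    proof -
      have "\<bar>log_kernel x y * f y\<bar> \<le> 2 * x\<^sup>2 / y\<^sup>2 * K"
        unfolding abs_mult using c assms that by (intro mult_mono abs_log_kernel_le abs_le) auto
      then show ?thesis by simp
    qed
  qed simp
  then have "set_integrable lborel ({0..c} \<union> {c<..}) (\<lambda>y. log_kernel x y * f y)"
    using set_integrable_log_kernel_Icc[OF assms] by (intro set_integrable_Un) auto
  then show ?thesis by (rule set_integrable_subset) auto
qed

subsection \<open>Shifting the singularity to the origin\<close>

lemma integrable_on_ln_shift: "(\<lambda>t. ln \<bar>t + c\<bar> * f (g t)) integrable_on {a..b}"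
  if "continuous_on {a..b} g" for a b c :: real
  by (rule set_borel_integral_eq_integral(1)[OF set_integrable_ln_shift[OF that]])

lemmas integrable_on_ln = integrable_on_ln_shift[where c = 0, simplified]

lemma integral_log_kernel_Icc:
  assumes "0 \<le> x"
  shows "integral {0..B} (\<lambda>y. log_kernel x y * f y) = integral {0..B} (\<lambda>y. ln \<bar>y - x\<bar> * f y)
    + integral {0..B} (\<lambda>y. ln \<bar>y + x\<bar> * f y) - 2 * integral {0..B} (\<lambda>y. ln \<bar>y\<bar> * f y)"
proof -
  note integrable = integrable_on_ln_shift[OF continuous_on_id, of "- x" 0 B]
    integrable_on_ln_shift[OF continuous_on_id, of x 0 B] integrable_on_ln[OF continuous_on_id, of 0 B]
  have "integral {0..B} (\<lambda>y. log_kernel x y * f y)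
      = integral {0..B} (\<lambda>y. ln \<bar>y - x\<bar> * f y + ln \<bar>y + x\<bar> * f y - 2 * (ln \<bar>y\<bar> * f y))"
    by (rule integral_spike[of "{0, x}"]) (use assms in \<open>auto simp: log_kernel_split algebra_simps\<close>)
  then show ?thesis
    using integrable
    by (simp add: Henstock_Kurzweil_Integration.integral_diff Henstock_Kurzweil_Integration.integral_add
        integrable_add integrable_on_cmult_left)
qed

lemma integral_log_kernel_shift:
  assumes "0 \<le> x" "x \<le> B"
  shows "integral {0..B} (\<lambda>y. log_kernel x y * f y) = integral {0..B - x} (\<lambda>t. ln \<bar>t\<bar> * f (x + t))
    + integral {0..B + x} (\<lambda>t. ln \<bar>t\<bar> * f (x - t)) - 2 * integral {0..B} (\<lambda>t. ln \<bar>t\<bar> * f t)"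
proof -
  let ?g = "\<lambda>t. ln \<bar>t\<bar> * f (x + t)"
  have left: "integral {0..B} (\<lambda>y. ln \<bar>y - x\<bar> * f y)
      = integral {0..x} (\<lambda>t. ln \<bar>t\<bar> * f (x - t)) + integral {0..B - x} ?g"
  proof -
    have "integral {0..B} (\<lambda>y. ln \<bar>y - x\<bar> * f y) = integral {- x..B - x} ?g"
      using integral_shift_real_ivl[of 0 x B "\<lambda>y. ln \<bar>y - x\<bar> * f y"] by (simp add: add.commute)
    also have "\<dots> = integral {- x..0} ?g + integral {0..B - x} ?g"
      by (rule Henstock_Kurzweil_Integration.integral_combine[symmetric])
        (use assms in \<open>auto intro!: integrable_on_ln continuous_intros\<close>)
    also have "integral {- x..0} ?g = integral {- x..- 0} (\<lambda>t. ln \<bar>- t\<bar> * f (x - - t))"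
      by simp
    also have "\<dots> = integral {0..x} (\<lambda>t. ln \<bar>t\<bar> * f (x - t))"
      by (rule Henstock_Kurzweil_Integration.integral_reflect_real)
    finally show ?thesis .
  qed
  have right: "integral {0..B} (\<lambda>y. ln \<bar>y + x\<bar> * f y) = integral {x..B + x} (\<lambda>t. ln \<bar>t\<bar> * f (x - t))"
    using integral_shift_real_ivl[of 0 "- x" B "\<lambda>y. ln \<bar>y + x\<bar> * f y"] even[of "x - _"] by simp
  have "integral {0..x} (\<lambda>t. ln \<bar>t\<bar> * f (x - t)) + integral {x..B + x} (\<lambda>t. ln \<bar>t\<bar> * f (x - t))
      = integral {0..B + x} (\<lambda>t. ln \<bar>t\<bar> * f (x - t))"
    by (intro Henstock_Kurzweil_Integration.integral_combine integrable_on_ln continuous_intros)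
      (use assms in auto)
  then show ?thesis using integral_log_kernel_Icc[OF assms(1)] left right by simp
qed

definition shift_defect :: "real \<Rightarrow> real \<Rightarrow> real" where
  "shift_defect x B = integral {B..B + x} (\<lambda>t. ln \<bar>t\<bar> * f (x - t) - ln \<bar>t - x\<bar> * f t)"

lemma integral_log_kernel_eq_second_difference:
  assumes "0 \<le> x" "x < B"
  shows "integral {0..B} (\<lambda>y. log_kernel x y * f y)
    = integral {0..B} (\<lambda>t. ln \<bar>t\<bar> * second_difference x t) + shift_defect x B"
proof -
  note integrable = integrable_on_ln[OF continuous_on_add[OF continuous_on_const continuous_on_id]]
    integrable_on_ln[OF continuous_on_diff[OF continuous_on_const continuous_on_id]]
    integrable_on_ln[OF continuous_on_id]
  have plus: "integral {0..B - x} (\<lambda>t. ln \<bar>t\<bar> * f (x + t)) + integral {B - x..B} (\<lambda>t. ln \<bar>t\<bar> * f (x + t))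
      = integral {0..B} (\<lambda>t. ln \<bar>t\<bar> * f (x + t))"
    by (rule Henstock_Kurzweil_Integration.integral_combine) (use assms integrable in auto)
  have minus: "integral {0..B} (\<lambda>t. ln \<bar>t\<bar> * f (x - t)) + integral {B..B + x} (\<lambda>t. ln \<bar>t\<bar> * f (x - t))
      = integral {0..B + x} (\<lambda>t. ln \<bar>t\<bar> * f (x - t))"
    by (rule Henstock_Kurzweil_Integration.integral_combine) (use assms integrable in auto)
  have "integral {B - x..B} (\<lambda>t. ln \<bar>t\<bar> * f (x + t)) = integral {B..B + x} (\<lambda>t. ln \<bar>t - x\<bar> * f t)"
    using integral_shift_real_ivl[of B x "B + x" "\<lambda>t. ln \<bar>t - x\<bar> * f t"] by (simp add: add.commute)
  moreover have "shift_defect x B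
      = integral {B..B + x} (\<lambda>t. ln \<bar>t\<bar> * f (x - t)) - integral {B..B + x} (\<lambda>t. ln \<bar>t - x\<bar> * f t)"
    unfolding shift_defect_def
    using set_borel_integral_eq_integral(1)[OF set_integrable_ln_shift[of B "B + x" "\<lambda>t. t" "- x"]]
    by (intro Henstock_Kurzweil_Integration.integral_diff integrable) simp
  moreover have "integral {0..B} (\<lambda>t. ln \<bar>t\<bar> * second_difference x t)
      = integral {0..B} (\<lambda>t. ln \<bar>t\<bar> * f (x + t)) + integral {0..B} (\<lambda>t. ln \<bar>t\<bar> * f (x - t))
        - 2 * integral {0..B} (\<lambda>t. ln \<bar>t\<bar> * f t)"
  proof -
    have "integral {0..B} (\<lambda>t. ln \<bar>t\<bar> * second_difference x t)
        = integral {0..B} (\<lambda>t. (ln \<bar>t\<bar> * f (x + t) + ln \<bar>t\<bar> * f (x - t)) - 2 * (ln \<bar>t\<bar> * f t))"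
      by (simp add: second_difference_def algebra_simps)
    then show ?thesis
      by (simp add: Henstock_Kurzweil_Integration.integral_diff Henstock_Kurzweil_Integration.integral_add
          integrable_add integrable integrable_on_cmult_left)
  qed
  ultimately show ?thesis
    using integral_log_kernel_shift[of x B] assms plus minus by simp
qed

lemma abs_shift_defect_le:
  assumes "0 \<le> x" "x + 1 \<le> B"
  shows "\<bar>shift_defect x B\<bar> \<le> (ln (B + x) * (L * x / (1 + (B - x))) + K * (x / (B - x))) * x"
    (is "_ \<le> ?c * x")
proof -
  have "norm (shift_defect x B) \<le> ?c * (B + x - B)"
    unfolding shift_defect_def
  proof (rule integral_bound)
    show "continuous_on {B..B + x} (\<lambda>t. ln \<bar>t\<bar> * f (x - t) - ln \<bar>t - x\<bar> * f t)"
      using assms by (intro continuous_intros) auto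
    fix t assume t: "t \<in> {B..B + x}"
    have "ln \<bar>t\<bar> * f (x - t) - ln \<bar>t - x\<bar> * f t = ln t * (f (t - x) - f t) + f t * (ln t - ln (t - x))"
      using t assms even[of "t - x"] by (simp add: algebra_simps)
    also have "norm \<dots> \<le> \<bar>ln t\<bar> * \<bar>f (t - x) - f t\<bar> + \<bar>f t\<bar> * \<bar>ln t - ln (t - x)\<bar>"
      using abs_triangle_ineq by (simp flip: abs_mult)
    also have "\<dots> \<le> ?c"
    proof (intro add_mono mult_mono abs_le)
      have "\<bar>f (t - x) - f t\<bar> \<le> L * x / (1 + (t - x))"
        using log_lipschitz[of "t - x" t] t assms by simp
      also have "\<dots> \<le> L * x / (1 + (B - x))"
        using t assms L_nonneg by (intro divide_left_mono mult_pos_pos) auto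
      finally show "\<bar>f (t - x) - f t\<bar> \<le> L * x / (1 + (B - x))" .
      have "ln t - ln (t - x) = ln (t / (t - x))" using t assms by (simp add: ln_div)
      also have "\<dots> \<le> t / (t - x) - 1" using t assms by (intro ln_le_minus_one) auto
      also have "\<dots> = x / (t - x)" using t assms by (simp add: field_simps)
      also have "\<dots> \<le> x / (B - x)" using t assms by (intro divide_left_mono mult_pos_pos) auto
      finally show "\<bar>ln t - ln (t - x)\<bar> \<le> x / (B - x)" using t assms by simp
    qed (use t assms K_nonneg in auto)
    finally show "norm (ln \<bar>t\<bar> * f (x - t) - ln \<bar>t - x\<bar> * f t) \<le> ?c" .
  qed (use assms in auto)
  then show ?thesis by simp
qed

lemma continuous_on_ln_mult_difference_primitive:
  assumes "0 < B"
  shows "continuous_on {0..B} (\<lambda>t. ln t * difference_primitive x t)"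
proof -
  have "((\<lambda>t. ln t * difference_primitive x t) \<longlongrightarrow> 0) (at_right 0)"
  proof (rule Lim_null_comparison)
    show "((\<lambda>t. 2 * L * \<bar>x\<bar> * \<bar>t * ln t\<bar>) \<longlongrightarrow> 0) (at_right 0)" by real_asymp
    have "\<bar>difference_primitive x t\<bar> \<le> L * (2 * t) * \<bar>x\<bar>" if "0 < t" for t
    proof (rule abs_difference_primitive_le)
      show "\<bar>f (s - t) - f (s + t)\<bar> \<le> L * (2 * t)" for s
        using lipschitz_onD[OF lipschitz, of "s - t" "s + t"] that by (simp add: dist_real_def)
    qed
    then have "\<bar>ln t\<bar> * \<bar>difference_primitive x t\<bar> \<le> \<bar>ln t\<bar> * (L * (2 * t) * \<bar>x\<bar>)" if "0 < t" for t
      using that by (intro mult_left_mono) auto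
    then show "\<forall>\<^sub>F t in at_right 0. norm (ln t * difference_primitive x t) \<le> 2 * L * \<bar>x\<bar> * \<bar>t * ln t\<bar>"
      by (auto simp: eventually_at_filter abs_mult mult_ac)
  qed
  then have at_0: "((\<lambda>t. ln t * difference_primitive x t) \<longlongrightarrow> 0) (at 0 within {0..B})"
    using assms by (simp add: at_within_Icc_at_right)
  have "continuous_on {0<..} (\<lambda>t. ln t * difference_primitive x t)"
    by (intro continuous_intros continuous_on_difference_primitive) auto
  then have at_pos: "isCont (\<lambda>t. ln t * difference_primitive x t) t" if "0 < t" for t
    using that by (simp add: continuous_on_eq_continuous_at)
  show ?thesis
    unfolding continuous_on_eq_continuous_within
  proof
    fix t assume "t \<in> {0..B}"
    then show "continuous (at t within {0..B}) (\<lambda>t. ln t * difference_primitive x t)"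
      using at_0 continuous_at_imp_continuous_within[OF at_pos]
      by (cases "t = 0") (auto simp: continuous_within)
  qed
qed

lemma integral_potential_by_parts:
  assumes "0 < B"
  shows "integral {0..B} (\<lambda>t. difference_primitive x t / t) = ln B * difference_primitive x B
    + integral {0..B} (\<lambda>t. ln \<bar>t\<bar> * second_difference x t)"
proof -
  have "((\<lambda>t. difference_primitive x t / t - ln t * second_difference x t) has_integral
      ln B * difference_primitive x B - ln 0 * difference_primitive x 0) {0..B}"
  proof (rule fundamental_theorem_of_calculus_interior)
    show "continuous_on {0..B} (\<lambda>t. ln t * difference_primitive x t)"
      by (rule continuous_on_ln_mult_difference_primitive[OF assms])
    fix t assume "t \<in> {0<..<B}"
    then have "((\<lambda>t. ln t * difference_primitive x t) has_real_derivative
        1 / t * difference_primitive x t + - second_difference x t * ln t) (at t)"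
      by (intro DERIV_mult has_real_derivative_difference_primitive DERIV_ln_divide) auto
    then have "((\<lambda>t. ln t * difference_primitive x t) has_real_derivative
        difference_primitive x t / t - ln t * second_difference x t) (at t)"
      by (rule DERIV_cong) (simp add: algebra_simps)
    then show "((\<lambda>t. ln t * difference_primitive x t) has_vector_derivative
        difference_primitive x t / t - ln t * second_difference x t) (at t)"
      by (simp add: has_real_derivative_iff_has_vector_derivative)
  qed (use assms in auto)
  then have parts: "((\<lambda>t. difference_primitive x t / t - ln \<bar>t\<bar> * second_difference x t) has_integral
      ln B * difference_primitive x B - ln 0 * difference_primitive x 0) {0..B}"
    by (rule has_integral_eq[rotated]) simp
  have "(\<lambda>t. ln \<bar>t + 0\<bar> * second_difference x t) integrable_on {0..B}"
    unfolding second_difference_def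
    by (intro set_borel_integral_eq_integral(1) set_integrable_ln_abs_mult_Icc continuous_intros)
  from has_integral_add[OF parts integrable_integral[OF this]]
  show ?thesis by (simp add: integral_unique difference_primitive_def[of x 0])
qed

lemma abs_truncation_error_le:
  assumes x: "0 \<le> x" and B: "2 * x + 1 \<le> B"
  shows "\<bar>integral {0..B} (\<lambda>y. log_kernel x y * f y) - integral {0..B} (\<lambda>t. difference_primitive x t / t)\<bar>
    \<le> (ln (B + x) * (L * x / (1 + (B - x))) + K * (x / (B - x))) * x + ln B * (4 * L * x / B * x)"
    (is "\<bar>?I - ?P\<bar> \<le> ?bound")
proof -
  have "?I - ?P = shift_defect x B - ln B * difference_primitive x B"
    using integral_log_kernel_eq_second_difference[of x B] integral_potential_by_parts[of B x] x B by simp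
  then have "\<bar>?I - ?P\<bar> \<le> \<bar>shift_defect x B\<bar> + \<bar>ln B\<bar> * \<bar>difference_primitive x B\<bar>"
    by (metis abs_mult abs_triangle_ineq4)
  also have "\<dots> \<le> ?bound"
  proof (intro add_mono mult_mono abs_shift_defect_le)
    have "\<bar>f (s - B) - f (s + B)\<bar> \<le> 4 * L * x / B" if "\<bar>s\<bar> \<le> \<bar>x\<bar>" for s
      by (rule abs_symmetric_difference_far_le) (use that x B in auto)
    then show "\<bar>difference_primitive x B\<bar> \<le> 4 * L * x / B * x"
      using abs_difference_primitive_le[of x B "4 * L * x / B"] x by simp
  qed (use x B in auto)
  finally show ?thesis .
qed

lemma integral_log_kernel_eq_potential_nonneg:
  assumes x: "0 \<le> x"
  shows "(LBINT y:{0<..}. log_kernel x y * f y) = potential x"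
proof -
  have "((\<lambda>B. integral {0..B} (\<lambda>y. log_kernel x y * f y)
      - integral {0..B} (\<lambda>t. difference_primitive x t / t)) \<longlongrightarrow> 0) at_top"
  proof (rule Lim_null_comparison)
    show "((\<lambda>B. (ln (B + x) * (L * x / (1 + (B - x))) + K * (x / (B - x))) * x
        + ln B * (4 * L * x / B * x)) \<longlongrightarrow> 0) at_top"
      by real_asymp
  qed (use abs_truncation_error_le[OF x] in
      \<open>auto intro: eventually_mono[OF eventually_ge_at_top[of "2 * x + 1"]]\<close>)
  then have "(LBINT y:{0<..}. log_kernel x y * f y) - potential x = 0"
    unfolding potential_def
    by (rule tendsto_unique[OF trivial_limit_at_top_linorder tendsto_diff[OF
          tendsto_integral_Icc_at_top[OF set_integrable_log_kernel[OF x]]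
          tendsto_integral_Icc_at_top[OF set_integrable_potential]]])
  then show ?thesis by simp
qed

lemma Top_eq_potential: "Top f x = potential x / pi"
proof -
  have "log_kernel \<bar>x\<bar> = log_kernel x" "potential \<bar>x\<bar> = potential x"
    by (auto simp: log_kernel_def[abs_def] potential_def difference_primitive_minus abs_if)
  then show ?thesis
    using integral_log_kernel_eq_potential_nonneg[of "\<bar>x\<bar>"]
    by (simp add: Top_def log_kernel_def)
qed

lemma Top_has_real_derivative: "(Top f has_real_derivative hilbert f x / pi) (at x)"
  unfolding Top_eq_potential[abs_def] by (rule DERIV_cdivide[OF potential_has_real_derivative])

end

section \<open>Weak derivatives and Sobolev spaces\<close>

lemma test_fun_vanishes_outside:
  assumes "test_fun fs"
  obtains R where "R > 0" "\<And>j x. R \<le> \<bar>x\<bar> \<Longrightarrow> fs j x = 0"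
proof -
  obtain K where K: "compact K" "\<And>x. x \<notin> K \<Longrightarrow> fs 0 x = 0"
    and der: "\<And>n x. (fs n has_real_derivative fs (Suc n) x) (at x)"
    using assms unfolding test_fun_def by blast
  have vanish: "fs j x = 0" if "x \<notin> K" for j x
    using that
  proof (induction j arbitrary: x)
    case (Suc j)
    have "((\<lambda>x. 0) has_real_derivative fs (Suc j) x) (at x)"
      by (rule has_field_derivative_transform_within_open[OF der[of j x], of "- K"])
        (use Suc K(1) compact_imp_closed in \<open>auto simp: open_Compl\<close>)
    then show ?case using DERIV_unique DERIV_const by blast
  qed (use K in auto)
  obtain B where B: "\<And>x. x \<in> K \<Longrightarrow> \<bar>x\<bar> \<le> B"
    using compact_imp_bounded[OF K(1)] unfolding bounded_iff by auto
  have "fs j x = 0" if "\<bar>B\<bar> + 1 \<le> \<bar>x\<bar>" for j x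
    using B[of x] that by (intro vanish) fastforce
  then show thesis by (rule that[of "\<bar>B\<bar> + 1", rotated]) auto
qed

lemma integral_by_parts_test_fun:
  fixes u u' :: "real \<Rightarrow> real"
  assumes u: "\<And>x. (u has_real_derivative u' x) (at x)" and "continuous_on UNIV u'" and fs: "test_fun fs"
  shows "(LINT x|lborel. u x * fs (Suc j) x) = - (LINT x|lborel. u' x * fs j x)"
proof -
  obtain R where R: "R > 0" "\<And>j x. R \<le> \<bar>x\<bar> \<Longrightarrow> fs j x = 0"
    using test_fun_vanishes_outside[OF fs] by metis
  have der: "(fs n has_real_derivative fs (Suc n) x) (at x)" for n x
    using fs unfolding test_fun_def by blast
  have supported: "v x * fs n x * indicator {- R..R} x = v x * fs n x" for v :: "real \<Rightarrow> real" and n x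
    using R(2)[of x n] by (cases "\<bar>x\<bar> \<le> R") (auto simp: indicator_def)
  have "(LINT x|lborel. u x * fs (Suc j) x * indicator {- R..R} x)
      = u R * fs j R - u (- R) * fs j (- R) - (LINT x|lborel. u' x * fs j x * indicator {- R..R} x)"
    using R(1) assms(2) DERIV_isCont[OF der]
    by (intro integral_by_parts u der) (auto simp: continuous_on_eq_continuous_at)
  then show ?thesis using R by (simp add: supported)
qed

lemma weak_deriv_if_has_real_derivative:
  assumes "\<And>x. (u has_real_derivative u' x) (at x)" "continuous_on UNIV u'"
  shows "weak_deriv u u'"
  unfolding weak_deriv_def
  using integral_by_parts_test_fun[OF assms, of _ 0]
  by (auto intro: borel_integrable_atLeastAtMost' continuous_on_subset[OF assms(2)])

lemma sobolev_H_if_L2_derivatives: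
  assumes der: "\<And>j x. (us j has_real_derivative us (Suc j) x) (at x)" and L2: "\<And>j. L2 (us j)"
  shows "sobolev_H k (us 0)"
proof -
  have cont: "continuous_on UNIV (us j)" for j
    by (rule DERIV_continuous_on[OF has_field_derivative_at_within[OF der]])
  have "(LINT x|lborel. us i x * fs j x) = (-1) ^ j * (LINT x|lborel. us (i + j) x * fs 0 x)"
    if "test_fun fs" for fs i j
  proof (induction j arbitrary: i)
    case (Suc j)
    then show ?case using integral_by_parts_test_fun[OF der cont that, of i j] by simp
  qed simp
  from this[where i = 0] show ?thesis
    unfolding sobolev_H_def using L2 by (intro exI[of _ us]) simp
qed

lemma L2_mult_bounded:
  assumes "L2 u" "g \<in> borel_measurable borel" "bounded (range g)"
  shows "L2 (\<lambda>x. u x * g x)"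
proof -
  obtain B where B: "\<And>x. \<bar>g x\<bar> \<le> B" using assms(3) unfolding bounded_iff by auto
  have u: "u \<in> borel_measurable borel" "integrable lborel (\<lambda>x. (u x)\<^sup>2)"
    using assms(1) by (simp_all add: L2_def)
  have "integrable lborel (\<lambda>x. (u x * g x)\<^sup>2)"
  proof (rule Bochner_Integration.integrable_bound)
    show "integrable lborel (\<lambda>x. B\<^sup>2 * (u x)\<^sup>2)" using u(2) by (rule integrable_mult_right)
    show "(\<lambda>x. (u x * g x)\<^sup>2) \<in> borel_measurable lborel" using u(1) assms(2) by simp
    have "(g x)\<^sup>2 \<le> B\<^sup>2" for x
      using power_mono[OF B[of x] abs_ge_zero, of 2] by simp
    then have "(u x * g x)\<^sup>2 \<le> B\<^sup>2 * (u x)\<^sup>2" for x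
      by (simp add: power_mult_distrib mult_mono mult.commute[of "(u x)\<^sup>2"])
    then show "AE x in lborel. norm ((u x * g x)\<^sup>2) \<le> norm (B\<^sup>2 * (u x)\<^sup>2)" by simp
  qed
  then show ?thesis using u(1) assms(2) by (simp add: L2_def)
qed

section \<open>The profile class\<close>

lemma convex_on_chord_le:
  fixes g :: "real \<Rightarrow> real"
  assumes "convex_on {0..} g" "0 \<le> s" "s \<le> t" "0 < t"
  shows "s * (g s - g t) \<le> (t - s) * (g 0 - g s)"
proof -
  define l where "l = s / t"
  have l: "0 \<le> l" "l \<le> 1" "l * t = s" using assms by (auto simp: l_def)
  have "g ((1 - l) *\<^sub>R 0 + l *\<^sub>R t) \<le> (1 - l) * g 0 + l * g t"
    by (rule convex_onD[OF assms(1)]) (use l assms in auto)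
  then have "t * g s \<le> t * ((1 - l) * g 0 + l * g t)"
    using l assms by (intro mult_left_mono) auto
  also have "\<dots> = (t - s) * g 0 + s * g t" by (simp add: algebra_simps flip: l(3))
  finally show ?thesis by (simp add: algebra_simps)
qed

lemma Dset_square_lipschitz:
  assumes "w \<in> Dset a" "0 \<le> x" "x \<le> y"
  shows "(1 + x\<^sup>2) * (w x - w y) \<le> 2 * (y\<^sup>2 - x\<^sup>2)"
proof (cases "x = 0")
  case True
  have "1 - y\<^sup>2 \<le> w y" "w 0 = 1" using assms(1) by (auto simp: Dset_def)
  then have "w 0 - w y \<le> 2 * y\<^sup>2" using zero_le_power2[of y] by linarith
  then show ?thesis by (simp add: True)
next
  case False
  have w: "convex_on {0..} (\<lambda>s. w (sqrt s))" "w 0 = 1" "1 - x\<^sup>2 \<le> w x" "0 \<le> w x"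
    using assms(1) by (auto simp: Dset_def)
  have squares: "0 < x\<^sup>2" "x\<^sup>2 \<le> y\<^sup>2" using False assms by (auto intro: power_mono)
  then have chord: "x\<^sup>2 * (w x - w y) \<le> (y\<^sup>2 - x\<^sup>2) * (1 - w x)"
    using convex_on_chord_le[OF w(1), of "x\<^sup>2" "y\<^sup>2"] assms w(2) by simp
  also have "\<dots> \<le> (y\<^sup>2 - x\<^sup>2) * x\<^sup>2" using squares w by (intro mult_left_mono) auto
  finally have "w x - w y \<le> y\<^sup>2 - x\<^sup>2" using squares by (simp add: mult.commute[of _ "x\<^sup>2"])
  moreover have "(y\<^sup>2 - x\<^sup>2) * (1 - w x) \<le> (y\<^sup>2 - x\<^sup>2) * 1"
    using squares w by (intro mult_left_mono) auto
  ultimately show ?thesis using chord by (simp add: distrib_right)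
qed

lemma even_log_lipschitz_Dset:
  assumes "w \<in> Dset a"
  shows "even_log_lipschitz w 1 10"
proof
  have bounds: "0 \<le> w x" "w x \<le> 1" for x using assms by (auto simp: Dset_def)
  then show "\<bar>w x\<bar> \<le> 1" for x by simp
  show "w (- x) = w x" for x using assms by (simp add: Dset_def)
  fix x y :: real assume xy: "0 \<le> x" "x \<le> y"
  have decreasing: "w y \<le> w x" using assms xy by (auto simp: Dset_def)
  have "(1 + x) * (w x - w y) \<le> 10 * (y - x)"
  proof (cases "y \<le> 2 * x + 1")
    case True
    have "(1 + x) * (y + x) \<le> (1 + x) * (3 * x + 1)" using True xy by (intro mult_left_mono) auto
    also have "\<dots> \<le> 5 * (1 + x\<^sup>2)"
      using zero_le_power2[of "x - 1"] by (simp add: power2_eq_square algebra_simps)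
    finally have "2 * (y - x) * ((1 + x) * (y + x)) \<le> 2 * (y - x) * (5 * (1 + x\<^sup>2))"
      using xy by (intro mult_left_mono) auto
    moreover have "(1 + x) * ((1 + x\<^sup>2) * (w x - w y)) \<le> (1 + x) * (2 * (y\<^sup>2 - x\<^sup>2))"
      using xy by (intro mult_left_mono Dset_square_lipschitz[OF assms]) auto
    ultimately have "(1 + x\<^sup>2) * ((1 + x) * (w x - w y)) \<le> (1 + x\<^sup>2) * (10 * (y - x))"
      by (simp add: power2_eq_square algebra_simps)
    moreover have "0 < 1 + x\<^sup>2" by (simp add: add_pos_nonneg)
    ultimately show ?thesis by simp
  next
    case False
    have "(1 + x) * (w x - w y) \<le> (1 + x) * 1"
      using bounds[of x] bounds[of y] xy by (intro mult_left_mono) auto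
    also have "\<dots> \<le> 10 * (y - x)" using False xy by simp
    finally show ?thesis .
  qed
  then show "\<bar>w x - w y\<bar> \<le> 10 * (y - x) / (1 + x)"
    using xy decreasing by (simp add: pos_le_divide_eq mult.commute)
qed

lemma Dset_half_less_1:
  assumes "w \<in> Dset a"
  shows "w (1 / 2) < 1"
proof (rule ccontr)
  assume "\<not> w (1 / 2) < 1"
  moreover have antimono: "\<And>x y. 0 \<le> x \<Longrightarrow> x \<le> y \<Longrightarrow> w y \<le> w x" and le_1: "\<And>x. w x \<le> 1"
    using assms unfolding Dset_def by auto
  ultimately have "w (1 / 2) = 1" by (metis less_eq_real_def)
  then have flat: "w (1 / 2 + h) = w (1 / 2)" if "- 1 / 2 < h" "h < 0" for h
    using antimono[of "1 / 2 + h" "1 / 2"] le_1[of "1 / 2 + h"] that by simp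
  obtain l where l: "((\<lambda>h. (w (1/2 + h) - w (1/2)) / h) \<longlongrightarrow> l) (at_left 0)" "l \<le> - eta a"
    using assms unfolding Dset_def by blast
  have "\<forall>\<^sub>F h in at_left 0. (w (1/2 + h) - w (1/2)) / h = 0"
    unfolding eventually_at_left_field using flat by (intro exI[of _ "- 1 / 2"]) simp
  from Lim_transform_eventually[OF l(1) this] have "l = 0" by (simp add: tendsto_const_iff)
  moreover have "eta a > 0" unfolding eta_def by (simp add: add_pos_nonneg)
  ultimately show False using l(2) by simp
qed

section \<open>Fixed points\<close>

locale profile_fixed_point = even_log_lipschitz \<omega> 1 L for \<omega> :: "real \<Rightarrow> real" and L :: real +
  fixes a :: real
  assumes a_nonzero: "a \<noteq> 0"
    and fixed_point: "Ra a \<omega> x = ereal (\<omega> x)"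
    and \<omega>_0: "\<omega> 0 = 1"
    and \<omega>_nonneg: "0 \<le> \<omega> x"
    and \<omega>_lower: "1 - x\<^sup>2 \<le> \<omega> x"
    and \<omega>_antimono: "0 \<le> x \<Longrightarrow> x \<le> y \<Longrightarrow> \<omega> y \<le> \<omega> x"
    and \<omega>_half: "\<omega> (1 / 2) < 1"
begin

lemma \<omega>_le_1: "\<omega> x \<le> 1"
  using abs_le[of x] by simp

lemma \<omega>_powr_le_1: "0 \<le> q \<Longrightarrow> \<omega> x powr q \<le> 1"
  using \<omega>_nonneg \<omega>_le_1 by (simp add: powr_le1)

lemma rfun_pos: "rfun \<omega> > 0"
proof -
  have "0 < (1 - \<omega> (1 / 2)) / (1 / 2)" using \<omega>_half by simp
  also have "\<dots> = (LBINT y:{0<..}. tail_envelope (1 / 2) 0 (1 - \<omega> (1 / 2)) y)"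
    by (simp add: set_integral_tail_envelope)
  also have "\<dots> \<le> (LBINT y:{0<..}. (\<omega> 0 - \<omega> y) / y\<^sup>2)"
  proof (rule set_integral_mono)
    show "set_integrable lborel {0<..} (tail_envelope (1 / 2) 0 (1 - \<omega> (1 / 2)))"
      by (rule set_integrable_tail_envelope) simp
    show "set_integrable lborel {0<..} (\<lambda>y. (\<omega> 0 - \<omega> y) / y\<^sup>2)"
    proof (rule set_integrable_continuous_dominated)
      show "set_integrable lborel {0<..} (tail_envelope 1 1 1)"
        by (rule set_integrable_tail_envelope) simp
      show "continuous_on {0<..} (\<lambda>y. (\<omega> 0 - \<omega> y) / y\<^sup>2)"
        by (intro continuous_intros) auto
      show "\<bar>(\<omega> 0 - \<omega> y) / y\<^sup>2\<bar> \<le> tail_envelope 1 1 1 y" if "y \<in> {0<..}" for y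
        using that \<omega>_nonneg[of y] \<omega>_lower[of y] \<omega>_le_1[of y]
        by (simp add: tail_envelope_def \<omega>_0 divide_le_eq divide_right_mono)
    qed simp
    show "tail_envelope (1 / 2) 0 (1 - \<omega> (1 / 2)) y \<le> (\<omega> 0 - \<omega> y) / y\<^sup>2" if "y \<in> {0<..}" for y
      using that \<omega>_le_1[of y] \<omega>_antimono[of "1 / 2" y]
      by (simp add: tail_envelope_def \<omega>_0 divide_right_mono)
  qed
  finally show ?thesis by (simp add: rfun_def)
qed

definition base :: "real \<Rightarrow> real" where
  "base x = 1 - a * Top \<omega> x / rfun \<omega>"

lemma \<omega>_eq_base_powr: "base x > 0 \<Longrightarrow> \<omega> x = base x powr (1 / a)"
  using fixed_point[of x] by (simp add: Ra_def Let_def flip: base_def)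

lemma base_pos: "\<omega> x > 0 \<Longrightarrow> base x > 0"
  using fixed_point[of x]
  by (auto simp: Ra_def Let_def zero_ereal_def simp flip: base_def split: if_splits)

lemma \<omega>_pos_if_a_neg:
  assumes "a < 0"
  shows "\<omega> x > 0"
proof -
  have "base x > 0"
    using fixed_point[of x] assms by (auto simp: Ra_def Let_def simp flip: base_def split: if_splits)
  then show ?thesis using \<omega>_eq_base_powr by simp
qed

definition \<kappa> :: real where
  "\<kappa> = 1 / (pi * rfun \<omega>)"

lemma \<kappa>_pos: "\<kappa> > 0"
  using rfun_pos by (simp add: \<kappa>_def)

lemma base_has_real_derivative: "(base has_real_derivative - (a * \<kappa> * hilbert \<omega> x)) (at x)"
  unfolding base_def
  using rfun_pos by (auto intro!: derivative_eq_intros Top_has_real_derivative simp: \<kappa>_def)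

lemma \<omega>_powr_has_real_derivative:
  assumes "\<omega> x > 0"
  shows "((\<lambda>x. \<omega> x powr q) has_real_derivative - (q * \<kappa>) * (\<omega> x powr (q - a) * hilbert \<omega> x)) (at x)"
proof -
  have pos: "base x > 0" by (rule base_pos[OF assms])
  have "isCont base x" by (rule DERIV_isCont[OF base_has_real_derivative])
  then have "\<forall>\<^sub>F y in nhds x. base y > 0"
    using pos by (simp add: isCont_def tendsto_at_iff_tendsto_nhds order_tendstoD)
  then have powr_eq: "\<forall>\<^sub>F y in nhds x. \<omega> y powr q = base y powr (q / a)"
    by (rule eventually_mono) (simp add: \<omega>_eq_base_powr powr_powr)
  have "base x powr (q / a - 1) = \<omega> x powr (q - a)"
    using a_nonzero by (simp add: \<omega>_eq_base_powr[OF pos] powr_powr diff_divide_distrib)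
  then have "((\<lambda>x. base x powr (q / a)) has_real_derivative
      - (q * \<kappa>) * (\<omega> x powr (q - a) * hilbert \<omega> x)) (at x)"
    using a_nonzero
      DERIV_chain2[OF has_real_derivative_powr[OF pos] base_has_real_derivative, of "q / a"]
    by (simp add: mult_ac)
  then show ?thesis using DERIV_cong_ev[OF refl powr_eq refl] by simp
qed

lemma \<omega>_has_real_derivative:
  assumes "\<omega> x > 0"
  shows "(\<omega> has_real_derivative - \<kappa> * (\<omega> x powr (1 - a) * hilbert \<omega> x)) (at x)"
  using \<omega>_powr_has_real_derivative[OF assms, of 1] \<omega>_nonneg by simp

subsection \<open>Bootstrapping the regularity\<close>

lemma hoelder_on_\<omega>_powr:
  assumes "convex S" "\<And>x. x \<in> S \<Longrightarrow> \<omega> x > 0"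
    and "bounded ((\<lambda>x. \<omega> x powr q) ` S)" "bounded ((\<lambda>x. \<omega> x powr (q - a)) ` S)"
  shows "hoelder_on 1 S (\<lambda>x. \<omega> x powr q)"
proof (rule hoelder_on_bounded_derivative[OF assms(1,3) \<omega>_powr_has_real_derivative[OF assms(2)]])
  obtain B where B: "\<And>x. x \<in> S \<Longrightarrow> \<omega> x powr (q - a) \<le> B"
    using assms(4) unfolding bounded_iff by fastforce
  have "\<bar>\<omega> x powr (q - a) * hilbert \<omega> x\<bar> \<le> B * (8 * 1 + 10 * L)" if "x \<in> S" for x
    unfolding abs_mult using B[OF that] order.trans[OF powr_ge_zero B[OF that]]
    by (intro mult_mono abs_hilbert_le) auto
  then have "bounded ((\<lambda>x. \<omega> x powr (q - a) * hilbert \<omega> x) ` S)"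
    unfolding bounded_iff by auto
  from bounded_scaleR_comp[OF this, of "- (q * \<kappa>)"]
  show "bounded ((\<lambda>x. - (q * \<kappa>) * (\<omega> x powr (q - a) * hilbert \<omega> x)) ` S)" by simp
qed

lemma hoelder_C_\<omega>_powr:
  assumes S: "convex S" "\<And>x. x \<in> S \<Longrightarrow> \<omega> x > 0" and hilbert: "hoelder_C n S (hilbert \<omega>)"
  shows "k \<le> Suc n \<Longrightarrow> (\<And>j. bounded ((\<lambda>x. \<omega> x powr (q - real j * a)) ` S)) \<Longrightarrow>
    hoelder_C k S (\<lambda>x. \<omega> x powr q)"
proof (induction k arbitrary: q)
  case 0
  then have "hoelder_on 1 S (\<lambda>x. \<omega> x powr q)"
    using hoelder_on_\<omega>_powr[OF S, of q] "0.prems"(2)[of 0] "0.prems"(2)[of 1] by simp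
  then show ?case by (auto intro!: exI[of _ 1])
next
  case (Suc k)
  have "bounded ((\<lambda>x. \<omega> x powr (q - a - real j * a)) ` S)" for j
    using Suc.prems(2)[of "Suc j"] by (simp add: algebra_simps)
  then have "hoelder_C k S (\<lambda>x. - (q * \<kappa>) * (\<omega> x powr (q - a) * hilbert \<omega> x))"
    using Suc.prems(1) by (intro hoelder_C_cmult hoelder_C_mult Suc.IH hoelder_C_mono[OF _ hilbert]) auto
  then show ?case
    using Suc by (intro hoelder_C_SucI[OF _ \<omega>_powr_has_real_derivative[OF S(2)]]) auto
qed

lemma hoelder_C_Suc_\<omega>:
  assumes "convex S" "\<And>x. x \<in> S \<Longrightarrow> \<omega> x > 0" "hoelder_C n S (hilbert \<omega>)"
    and "\<And>j. bounded ((\<lambda>x. \<omega> x powr (1 - real j * a)) ` S)"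
  shows "hoelder_C (Suc n) S \<omega>"
  using hoelder_C_\<omega>_powr[OF assms(1-3) le_refl assms(4)] \<omega>_nonneg by simp

subsection \<open>Growth of the potential\<close>

lemma excess_increment:
  assumes "0 \<le> x" "x \<le> y"
  shows "excess x + x * (\<omega> x - \<omega> y) \<le> excess y"
proof -
  have "F x - x * \<omega> y \<le> F y - y * \<omega> y"
  proof (rule DERIV_nonneg_imp_nondecreasing[OF assms(2)])
    fix z assume "x \<le> z" "z \<le> y"
    then have "0 \<le> \<omega> z - \<omega> y" using assms \<omega>_antimono[of z y] by simp
    moreover have "((\<lambda>z. F z - z * \<omega> y) has_real_derivative \<omega> z - \<omega> y) (at z)"
      by (auto intro!: derivative_eq_intros F_deriv)
    ultimately show "\<exists>D. ((\<lambda>z. F z - z * \<omega> y) has_real_derivative D) (at z) \<and> 0 \<le> D" by blast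
  qed
  then show ?thesis by (simp add: excess_def algebra_simps)
qed

lemma excess_mono:
  assumes "0 \<le> x" "x \<le> y"
  shows "excess x \<le> excess y"
proof -
  have "0 \<le> x * (\<omega> x - \<omega> y)" using assms \<omega>_antimono[OF assms] by simp
  then show ?thesis using excess_increment[OF assms] by linarith
qed

lemma excess_1_pos: "excess 1 > 0"
proof -
  have "\<omega> 1 < \<omega> 0" using \<omega>_half \<omega>_antimono[of "1 / 2" 1] \<omega>_0 by simp
  then have "\<forall>\<^sub>F x in at_right 0. \<omega> 1 < \<omega> x" by (rule order_tendstoD(1)[OF tendsto_at_right_f])
  then have "\<forall>\<^sub>F x in at_right 0. \<omega> 1 < \<omega> x \<and> x \<in> {0<..<1}"
    by (rule eventually_conj) (rule eventually_at_right_real[OF zero_less_one])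
  then obtain x where x: "\<omega> 1 < \<omega> x" "0 < x" "x < 1"
    using eventually_happens'[OF trivial_limit_at_right_real] by fastforce
  have "0 < x * (\<omega> x - \<omega> 1)" using x by simp
  also have "\<dots> \<le> excess 1"
    using excess_mono[of 0 x] excess_increment[of x 1] x by (simp add: excess_def[of 0])
  finally show ?thesis .
qed

lemma excess_pos: "1 \<le> x \<Longrightarrow> 0 < excess x"
  using excess_1_pos excess_mono[of 1 x] by simp

lemma excess_le: "0 \<le> x \<Longrightarrow> excess x \<le> x"
  unfolding excess_def using abs_F_le[of x] mult_nonneg_nonneg[OF _ \<omega>_nonneg, of x x] by simp

lemmas hilbert_\<omega>_ge_excess = hilbert_ge_excess[OF \<omega>_antimono]

lemma Top_ge_ln:
  assumes "1 \<le> x"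
  shows "Top \<omega> 1 + excess 1 / pi * ln x \<le> Top \<omega> x"
proof -
  define c where "c = excess 1 / pi"
  have "Top \<omega> 1 - c * ln 1 \<le> Top \<omega> x - c * ln x"
  proof (rule DERIV_nonneg_imp_nondecreasing[OF assms])
    fix y :: real assume y: "1 \<le> y" "y \<le> x"
    have "excess 1 / y \<le> excess y / y"
      using y by (intro divide_right_mono excess_mono) auto
    also have "\<dots> \<le> hilbert \<omega> y" by (rule hilbert_\<omega>_ge_excess) (use y in auto)
    finally have "excess 1 / y / pi \<le> hilbert \<omega> y / pi" by (intro divide_right_mono) auto
    then have "0 \<le> hilbert \<omega> y / pi - c * (1 / y)" by (simp add: c_def mult.commute)
    moreover have "((\<lambda>x. Top \<omega> x - c * ln x) has_real_derivative hilbert \<omega> y / pi - c * (1 / y)) (at y)"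
      using y by (intro DERIV_diff Top_has_real_derivative DERIV_cmult DERIV_ln_divide) auto
    ultimately show "\<exists>D. ((\<lambda>x. Top \<omega> x - c * ln x) has_real_derivative D) (at y) \<and> 0 \<le> D" by blast
  qed
  then show ?thesis by (simp add: c_def)
qed

subsection \<open>The case of positive \<open>a\<close>\<close>

lemma \<omega>_vanishes_if_a_pos:
  assumes "0 < a"
  obtains x0 where "0 < x0" "\<omega> x0 = 0"
proof -
  define c where "c = excess 1 / pi"
  define t where "t = max 0 ((rfun \<omega> / a - Top \<omega> 1) / c)"
  have "c > 0" using excess_1_pos by (simp add: c_def)
  moreover have "(rfun \<omega> / a - Top \<omega> 1) / c \<le> t" by (simp add: t_def)
  ultimately have "rfun \<omega> / a \<le> Top \<omega> 1 + c * t"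
    by (simp add: pos_divide_le_eq mult.commute)
  also have "\<dots> \<le> Top \<omega> (exp t)" using Top_ge_ln[of "exp t"] by (simp add: t_def c_def)
  finally have "base (exp t) \<le> 0"
    using assms rfun_pos by (simp add: base_def field_simps)
  then have "\<omega> (exp t) = 0" using base_pos[of "exp t"] \<omega>_nonneg[of "exp t"] by linarith
  then show thesis by (intro that[of "exp t"]) auto
qed

definition support_radius :: ereal where
  "support_radius = Sup (ereal ` {x. \<omega> x > 0})"

lemma support_radius_finite:
  assumes "0 < a"
  shows "support_radius < \<infinity>"
proof -
  obtain x0 where "0 < x0" "\<omega> x0 = 0" using \<omega>_vanishes_if_a_pos[OF assms] .
  then have "x \<le> x0" if "\<omega> x > 0" for x
    using \<omega>_antimono[of x0 x] that by (cases "x \<le> x0") auto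
  then have "support_radius \<le> ereal x0" unfolding support_radius_def by (intro Sup_least) auto
  then show ?thesis by (rule le_less_trans) simp
qed

lemma \<omega>_eq_0_outside_support:
  assumes "support_radius < ereal \<bar>x\<bar>"
  shows "\<omega> x = 0"
proof (rule ccontr)
  assume "\<omega> x \<noteq> 0"
  then have "0 < \<omega> \<bar>x\<bar>" using \<omega>_nonneg[of x] by (simp add: f_abs)
  then have "ereal \<bar>x\<bar> \<le> support_radius" unfolding support_radius_def by (intro Sup_upper) simp
  then show False using assms by simp
qed

lemma \<omega>_ge_inside:
  assumes "x \<in> {-b<..<b}"
  shows "\<omega> b \<le> \<omega> x"
proof -
  have "\<omega> b \<le> \<omega> \<bar>x\<bar>" by (rule \<omega>_antimono) (use assms in auto)
  then show ?thesis by (simp add: f_abs)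
qed

lemma bounded_\<omega>_powr:
  assumes "0 < \<omega> b"
  shows "bounded ((\<lambda>x. \<omega> x powr q) ` {-b<..<b})"
proof -
  have "\<omega> x powr q \<le> max 1 (\<omega> b powr q)" if "x \<in> {-b<..<b}" for x
  proof (cases "0 \<le> q")
    case True
    then show ?thesis using \<omega>_powr_le_1[of q x] by simp
  next
    case False
    have "\<omega> x powr q \<le> \<omega> b powr q"
      using False assms \<omega>_ge_inside[OF that] by (intro powr_mono2') auto
    then show ?thesis by simp
  qed
  then show ?thesis
    unfolding bounded_iff by (auto intro!: exI[of _ "max 1 (\<omega> b powr q)"])
qed

lemma hoelder_C_\<omega>_interior: "0 < b \<Longrightarrow> 0 < \<omega> b \<Longrightarrow> hoelder_C n {-b<..<b} \<omega>"
proof (induction n arbitrary: b)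
  case 0
  show ?case using hoelder_on_f by (auto intro!: exI[of _ 1])
next
  case (Suc n)
  from order_tendstoD(1)[OF tendsto_at_right_f Suc.prems(2)]
  have "\<forall>\<^sub>F y in at_right b. 0 < \<omega> y \<and> b < y"
    by (simp add: eventually_conj eventually_at_right_less)
  then obtain c where c: "b < c" "0 < \<omega> c"
    using eventually_happens'[OF trivial_limit_at_right_real] by fastforce
  have "hoelder_C n {-c<..<c} \<omega>" using Suc.IH[of c] c Suc.prems by simp
  then have hilbert: "hoelder_C n {-b<..<b} (hilbert \<omega>)"
    by (rule hoelder_C_hilbert[of "{-b<..<b}" "(c - b) / 2", rotated 3]) (use c in auto)
  have "0 < \<omega> x" if "x \<in> {-b<..<b}" for x
    using \<omega>_ge_inside[OF that] Suc.prems(2) by simp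
  then show ?case
    by (intro hoelder_C_Suc_\<omega> hilbert bounded_\<omega>_powr Suc.prems(2)) auto
qed

lemma smooth_inside_support:
  "smooth_on_set {x. - support_radius < ereal x \<and> ereal x < support_radius} \<omega>"
proof (rule smooth_on_set_if_hoelder_C)
  fix x assume "x \<in> {x. - support_radius < ereal x \<and> ereal x < support_radius}"
  then have "ereal \<bar>x\<bar> < support_radius" by (cases support_radius) auto
  then obtain b where b: "\<omega> b > 0" "\<bar>x\<bar> < b" unfolding support_radius_def less_Sup_iff by auto
  then show "\<exists>U. open U \<and> x \<in> U \<and> (\<forall>n. hoelder_C n U \<omega>)"
    by (intro exI[of _ "{-b<..<b}"]) (auto intro: hoelder_C_\<omega>_interior)
qed

subsection \<open>The case of negative \<open>a\<close>\<close>

context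
  assumes a_neg: "a < 0"
begin

lemmas \<omega>_pos = \<omega>_pos_if_a_neg[OF a_neg]

lemma bounded_\<omega>_powr_UNIV: "0 \<le> q \<Longrightarrow> bounded (range (\<lambda>x. \<omega> x powr q))"
  using \<omega>_powr_le_1 by (auto simp: bounded_iff)

lemma hoelder_C_hilbert_UNIV: "hoelder_C n UNIV \<omega> \<Longrightarrow> hoelder_C n UNIV (hilbert \<omega>)"
  by (rule hoelder_C_hilbert[of UNIV 1]) auto

lemma hoelder_C_\<omega>: "hoelder_C n UNIV \<omega>"
proof (induction n)
  case 0
  show ?case using hoelder_on_f by (auto intro!: exI[of _ 1])
next
  case (Suc n)
  have "0 \<le> 1 - real j * a" for j using a_neg mult_nonneg_nonpos[of "real j" a] by simp
  then show ?case
    by (intro hoelder_C_Suc_\<omega> hoelder_C_hilbert_UNIV Suc \<omega>_pos bounded_\<omega>_powr_UNIV) auto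
qed

lemma hoelder_C_\<omega>_powr_UNIV:
  assumes "0 \<le> q"
  shows "hoelder_C n UNIV (\<lambda>x. \<omega> x powr q)"
proof (rule hoelder_C_\<omega>_powr[OF convex_UNIV \<omega>_pos hoelder_C_hilbert_UNIV[OF hoelder_C_\<omega>[of n]]])
  show "bounded (range (\<lambda>x. \<omega> x powr (q - real j * a)))" for j
    using assms a_neg mult_nonneg_nonpos[of "real j" a] by (intro bounded_\<omega>_powr_UNIV) simp
qed simp

lemma funpow_deriv_\<omega>_has_real_derivative:
  "((deriv ^^ j) \<omega> has_real_derivative (deriv ^^ Suc j) \<omega> x) (at x)"
  by (rule has_real_derivative_funpow_deriv[OF open_UNIV hoelder_C_\<omega>]) simp

lemma funpow_deriv_\<omega>_factor:
  "\<exists>g. (\<forall>n. hoelder_C n UNIV g) \<and> (deriv ^^ Suc j) \<omega> = (\<lambda>x. \<omega> x powr (1 - a) * g x)"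
proof (induction j)
  case 0
  have "deriv \<omega> x = \<omega> x powr (1 - a) * (- \<kappa> * hilbert \<omega> x)" for x
    using DERIV_imp_deriv[OF \<omega>_has_real_derivative[OF \<omega>_pos]] by simp
  then show ?case
    using hoelder_C_cmult[OF hoelder_C_hilbert_UNIV[OF hoelder_C_\<omega>], of _ "- \<kappa>"]
    by (intro exI[of _ "\<lambda>x. - \<kappa> * hilbert \<omega> x"]) auto
next
  case (Suc j)
  then obtain g where g: "\<And>n. hoelder_C n UNIV g" "(deriv ^^ Suc j) \<omega> = (\<lambda>x. \<omega> x powr (1 - a) * g x)"
    by blast
  define h where "h x = deriv g x + - ((1 - a) * \<kappa>) * (\<omega> x powr (- a) * (hilbert \<omega> x * g x))" for x
  have "hoelder_C n UNIV h" for n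
    unfolding h_def using a_neg
    by (intro hoelder_C_add hoelder_C_Suc_deriv(1) hoelder_C_cmult hoelder_C_mult
        hoelder_C_\<omega>_powr_UNIV hoelder_C_hilbert_UNIV hoelder_C_\<omega> g(1) open_UNIV) auto
  moreover have "(deriv ^^ Suc (Suc j)) \<omega> = (\<lambda>x. \<omega> x powr (1 - a) * h x)"
  proof
    fix x
    have "(deriv ^^ Suc (Suc j)) \<omega> x = deriv (\<lambda>x. \<omega> x powr (1 - a) * g x) x"
      using g(2) by simp
    also have "\<dots> = - ((1 - a) * \<kappa>) * (\<omega> x powr (1 - a - a) * hilbert \<omega> x) * g x
        + deriv g x * \<omega> x powr (1 - a)"
      by (rule DERIV_imp_deriv[OF DERIV_mult[OF \<omega>_powr_has_real_derivative[OF \<omega>_pos]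
              hoelder_C_Suc_deriv(2)[OF open_UNIV g(1) UNIV_I]]])
    also have "\<omega> x powr (1 - a - a) = \<omega> x powr (1 - a) * \<omega> x powr (- a)"
      by (simp flip: powr_add)
    finally show "(deriv ^^ Suc (Suc j)) \<omega> x = \<omega> x powr (1 - a) * h x"
      by (simp add: h_def algebra_simps)
  qed
  ultimately show ?case by blast
qed

lemma ln_excess_has_real_derivative:
  assumes "1 \<le> x"
  obtains D where "((\<lambda>x. ln (excess x)) has_real_derivative D) (at x)" "\<kappa> * \<omega> x powr (1 - a) \<le> D"
proof -
  have pos: "0 < excess x" by (rule excess_pos[OF assms])
  have "(excess has_real_derivative x * (\<kappa> * (\<omega> x powr (1 - a) * hilbert \<omega> x))) (at x)"
    unfolding excess_def[abs_def]
    by (auto intro!: derivative_eq_intros F_deriv \<omega>_has_real_derivative \<omega>_pos)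
  from DERIV_chain2[OF DERIV_ln_divide[OF pos] this]
  have "((\<lambda>x. ln (excess x)) has_real_derivative
      1 / excess x * (x * (\<kappa> * (\<omega> x powr (1 - a) * hilbert \<omega> x)))) (at x)" .
  moreover have "\<kappa> * \<omega> x powr (1 - a) = 1 / excess x * (x * (\<kappa> * (\<omega> x powr (1 - a) * (excess x / x))))"
    using pos assms by simp
  then have "\<kappa> * \<omega> x powr (1 - a) \<le> 1 / excess x * (x * (\<kappa> * (\<omega> x powr (1 - a) * hilbert \<omega> x)))"
    using pos assms \<kappa>_pos hilbert_\<omega>_ge_excess[of x] by (simp only:) (intro mult_left_mono, auto)
  ultimately show thesis by (rule that)
qed

(* ln (excess) has slope at least \<kappa> * \<omega> x powr (1 - a) on [x / 2, x], but grows only logarithmically. *)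
lemma \<omega>_powr_le_ln:
  assumes x: "2 \<le> x"
  shows "\<kappa> * (x / 2) * \<omega> x powr (1 - a) \<le> ln x - ln (excess 1)"
proof -
  define c where "c = \<kappa> * \<omega> x powr (1 - a)"
  have "ln (excess (x / 2)) - c * (x / 2) \<le> ln (excess x) - c * x"
  proof (rule DERIV_nonneg_imp_nondecreasing[of "x / 2" x "\<lambda>y. ln (excess y) - c * y"])
    fix y assume y: "x / 2 \<le> y" "y \<le> x"
    then obtain D where D: "((\<lambda>x. ln (excess x)) has_real_derivative D) (at y)"
        "\<kappa> * \<omega> y powr (1 - a) \<le> D"
      using ln_excess_has_real_derivative[of y] x by auto
    have "c \<le> \<kappa> * \<omega> y powr (1 - a)"
      unfolding c_def using \<kappa>_pos a_neg y x \<omega>_nonneg \<omega>_antimono[of y x]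
      by (intro mult_left_mono powr_mono2) auto
    moreover have "((\<lambda>y. ln (excess y) - c * y) has_real_derivative D - c * 1) (at y)"
      by (intro DERIV_diff D DERIV_cmult DERIV_ident)
    ultimately show "\<exists>D. ((\<lambda>y. ln (excess y) - c * y) has_real_derivative D) (at y) \<and> 0 \<le> D"
      using D(2) by (intro exI[of _ "D - c * 1"]) simp
  qed (use x in simp)
  moreover have "ln (excess x) \<le> ln x" "ln (excess 1) \<le> ln (excess (x / 2))"
    using x excess_pos excess_le[of x] excess_mono[of 1 "x / 2"] by auto
  ultimately show ?thesis by (simp add: c_def algebra_simps)
qed

lemma \<omega>_powr_square_decay:
  obtains C where "\<And>x. 2 \<le> x \<Longrightarrow> (\<omega> x powr (1 - a))\<^sup>2 \<le> C * x powr (-3/2)"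
proof -
  define D where "D = (4 + \<bar>ln (excess 1)\<bar>) * 2 / \<kappa>"
  have "(\<omega> x powr (1 - a))\<^sup>2 \<le> D\<^sup>2 * x powr (-3/2)" if x: "2 \<le> x" for x
  proof -
    have "\<kappa> * (x / 2) * \<omega> x powr (1 - a) \<le> ln x + \<bar>ln (excess 1)\<bar>"
      using \<omega>_powr_le_ln[OF x] by linarith
    also have "\<dots> \<le> 4 * x powr (1/4) + \<bar>ln (excess 1)\<bar> * x powr (1/4)"
      using ln_powr_bound[of x "1/4"] mult_left_mono[of 1 "x powr (1/4)" "\<bar>ln (excess 1)\<bar>"] x
      by (simp add: ge_one_powr_ge_zero)
    finally have "\<omega> x powr (1 - a) \<le> D * (x powr (1/4) / x)"
      using \<kappa>_pos x by (simp add: D_def field_simps)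
    also have "x powr (1/4) / x = x powr (-3/4)"
      using x powr_diff[of x "1/4" 1] by simp
    finally have "(\<omega> x powr (1 - a))\<^sup>2 \<le> (D * x powr (-3/4))\<^sup>2"
      by (intro power_mono) auto
    also have "\<dots> = D\<^sup>2 * x powr (-3/2)"
      by (simp add: power_mult_distrib power2_eq_square[of "x powr _"] flip: powr_add)
    finally show ?thesis .
  qed
  then show thesis by (rule that)
qed

lemma L2_\<omega>_powr: "L2 (\<lambda>x. \<omega> x powr (1 - a))"
proof -
  let ?f = "\<lambda>x. (\<omega> x powr (1 - a))\<^sup>2"
  have cont: "continuous_on A (\<lambda>x. \<omega> x powr (1 - a))" for A
    using \<omega>_pos by (intro continuous_intros) (auto simp: less_imp_neq[symmetric])
  obtain C where C: "\<And>x. 2 \<le> x \<Longrightarrow> ?f x \<le> C * x powr (-3/2)"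
    using \<omega>_powr_square_decay by metis
  have "set_integrable lborel {2<..} ?f"
  proof (rule set_integrable_continuous_dominated)
    show "set_integrable lborel {2<..} (\<lambda>x. C * x powr (-3/2))"
      by (intro set_integrable_mult_right set_integrable_powr_Ioi) auto
    show "continuous_on {2<..} ?f" by (intro continuous_intros cont)
  qed (use C in auto)
  moreover have "set_integrable lborel {0..2} ?f"
    by (intro borel_integrable_atLeastAtMost' continuous_intros cont)
  ultimately have "set_integrable lborel ({0..2} \<union> {2<..}) ?f"
    by (intro set_integrable_Un) auto
  then have "set_integrable lborel {0<..} ?f" by (rule set_integrable_subset) auto
  then have "integrable lborel ?f"
    by (rule integrable_even_if_set_integrable_Ioi) (simp add: even)
  then show ?thesis using borel_measurable_continuous_onI[OF cont] by (simp add: L2_def)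
qed

lemma L2_funpow_deriv_\<omega>: "L2 ((deriv ^^ Suc j) \<omega>)"
proof -
  obtain g where g: "\<And>n. hoelder_C n UNIV g" "(deriv ^^ Suc j) \<omega> = (\<lambda>x. \<omega> x powr (1 - a) * g x)"
    using funpow_deriv_\<omega>_factor[of j] by blast
  obtain \<alpha> where "0 < \<alpha>" "hoelder_on \<alpha> UNIV g" using hoelder_C_imp_hoelder_on[OF g(1)] by blast
  then have "g \<in> borel_measurable borel"
    by (intro borel_measurable_continuous_onI hoelder_on_imp_continuous_on)
  then show ?thesis unfolding g(2) by (intro L2_mult_bounded L2_\<omega>_powr hoelder_C_imp_bounded[OF g(1)])
qed

lemma weak_deriv_\<omega>: "weak_deriv \<omega> (deriv \<omega>)"
  using funpow_deriv_\<omega>_has_real_derivative[of 0]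
    DERIV_continuous_on[OF has_field_derivative_at_within[OF funpow_deriv_\<omega>_has_real_derivative[of 1]]]
  by (intro weak_deriv_if_has_real_derivative) auto

lemma sobolev_H_deriv_\<omega>: "sobolev_H k (deriv \<omega>)"
  using sobolev_H_if_L2_derivatives[of "\<lambda>j. (deriv ^^ Suc j) \<omega>" k,
      OF funpow_deriv_\<omega>_has_real_derivative L2_funpow_deriv_\<omega>] by simp

end

end

lemma profile_fixed_point_Dset:
  assumes "\<omega> \<in> Dset a" "\<forall>x. Ra a \<omega> x = ereal (\<omega> x)" "a \<noteq> 0"
  shows "profile_fixed_point \<omega> 10 a"
proof (intro profile_fixed_point.intro profile_fixed_point_axioms.intro)
  show "even_log_lipschitz \<omega> 1 10" by (rule even_log_lipschitz_Dset[OF assms(1)])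
  show "0 \<le> \<omega> x" "1 - x\<^sup>2 \<le> \<omega> x" for x using assms(1) by (auto simp: Dset_def)
  show "\<omega> y \<le> \<omega> x" if "0 \<le> x" "x \<le> y" for x y using that assms(1) by (auto simp: Dset_def)
  show "\<omega> 0 = 1" using assms(1) by (simp add: Dset_def)
qed (use assms Dset_half_less_1 in auto)

theorem mainTheorem16:
  fixes a :: real and \<omega> :: "real \<Rightarrow> real"
  assumes "a < 0 \<or> (0 < a \<and> a < 1)"
    and "\<omega> \<in> Dset a"
    and "\<forall>x. Ra a \<omega> x = ereal (\<omega> x)"
  defines "L\<omega> \<equiv> Sup (ereal ` {x. \<omega> x > 0})"
  shows "(a < 0 \<longrightarrow> (\<forall>x. \<omega> x > 0) \<and> (\<exists>g. weak_deriv \<omega> g \<and> (\<forall>k. sobolev_H k g)))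
       \<and> (0 < a \<longrightarrow> L\<omega> < \<infinity> \<and> (\<forall>x. ereal \<bar>x\<bar> > L\<omega> \<longrightarrow> \<omega> x = 0)
              \<and> smooth_on_set {x. - L\<omega> < ereal x \<and> ereal x < L\<omega>} \<omega>)"
proof -
  interpret profile_fixed_point \<omega> 10 a
    using assms(1) by (intro profile_fixed_point_Dset assms(2,3)) auto
  have L\<omega>: "L\<omega> = support_radius" by (simp add: L\<omega>_def support_radius_def)
  show ?thesis
    unfolding L\<omega>
    using \<omega>_pos_if_a_neg weak_deriv_\<omega> sobolev_H_deriv_\<omega>
      support_radius_finite \<omega>_eq_0_outside_support smooth_inside_support by blast
qed

end
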